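(* Let $\alpha>1$ and $\beta>1$ be real numbers. Then $h(L(\alpha,\beta))$ is finite if and only if $\log_\alpha(\beta)$ is a rational number. Moreover, if $\log_\alpha(\beta) \in \mathbb{Q}$, that is, $\beta=\alpha^{p/q}$ for some $p,q \in \mathbb{N}$, then \[\left\lfloor \frac{1}{pq} \left\lfloor\sqrt{\frac{1}{\alpha^{1/q} - 1} } \right \rfloor \right\rfloor \leq h(L(\alpha,\beta)) \leq pq\cdot h(\alpha^p).\]
   Context: $\mathbb{N}_0=\{0,1,2,\dots\}$ and $\mathbb{N}=\{1,2,\dots\}$. For real numbers $\alpha,\beta>1$, $L(\alpha,\beta)=\{\alpha^n \colon n \in \mathbb{N}_0\}\times\{\beta^n \colon n \in \mathbb{N}_0\}\subseteq\mathbb{R}^2$, and $L(\alpha)=L(\alpha,\alpha)$. For a discrete set $S\subseteq\mathbb{R}^2$, a convex polygon $P$ with all vertices in $S$ is empty in $S$ if $P$ (including its boundary, in particular the interiors of its edges) contains no points of $S$ other than its vertices. $h(S)$ denotes the maximum number of vertices of an empty polygon in $S$, with $h(S)=\infty$ if there are empty polygons in $S$ with arbitrarily many vertices. For a real number $\gamma>1$, $h(\gamma)$ abbreviates $h(L(\gamma))$. *)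

theory Defs
  imports "HOL-Analysis.Analysis" "HOL-Library.Extended_Nat"
begin

definition exp_lattice :: "real \<Rightarrow> real \<Rightarrow> (real \<times> real) set" where
  "exp_lattice \<alpha> \<beta> = range (\<lambda>n::nat. \<alpha> ^ n) \<times> range (\<lambda>n::nat. \<beta> ^ n)"

text \<open>A convex polygon is a two-dimensional polytope in the plane; points and segments are
  not polygons.\<close>

definition convex_polygon :: "(real \<times> real) set \<Rightarrow> bool" where
  "convex_polygon P \<longleftrightarrow> polytope P \<and> aff_dim P = 2"

definition polygon_vertices :: "(real \<times> real) set \<Rightarrow> (real \<times> real) set" where
  "polygon_vertices P = {v. v extreme_point_of P}"

definition empty_polygon :: "(real \<times> real) set \<Rightarrow> (real \<times> real) set \<Rightarrow> bool" where
  "empty_polygon S P \<longleftrightarrow>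
     convex_polygon P \<and> polygon_vertices P \<subseteq> S \<and> P \<inter> S \<subseteq> polygon_vertices P"

text \<open>A supremum in \<^typ>\<open>enat\<close> is attained if the set of values is finite and nonempty, and is
  \<open>\<infinity>\<close> if the values are unbounded.\<close>

definition max_empty_polygon :: "(real \<times> real) set \<Rightarrow> enat" where
  "max_empty_polygon S = (SUP P \<in> {P. empty_polygon S P}. enat (card (polygon_vertices P)))"

end

theory Submission
  imports Defs "HOL-Library.Ramsey"
begin

text \<open>
  Empty polygons are handled through their vertex sets: finite \<open>V\<close> in convex position whose convex
  hull meets the lattice only in \<open>V\<close>. Since \<open>L(\<alpha>, \<beta>)\<close> is the union of \<open>k l\<close> scaled copies of
  \<open>L(\<alpha>\<^sup>k, \<beta>\<^sup>l)\<close> and such sets are inherited by sublattices, \<open>h(L(\<alpha>, \<beta>)) \<le> k l h(L(\<alpha>\<^sup>k, \<beta>\<^sup>l))\<close>.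
  With \<open>\<beta>\<^sup>q = \<alpha>\<^sup>p\<close> this is the upper bound; applied to \<open>L(\<delta>)\<close> with \<open>\<delta> = \<alpha>\<^bsup>1/q\<^esup>\<close> it reduces the
  lower bound to the points \<open>(\<delta>\<^sup>i, \<delta>\<^bsup>m-i\<^esup>)\<close> on a hyperbola.

  The same inequality reduces finiteness of \<open>h(\<gamma>)\<close> to \<open>\<gamma> \<ge> 4\<close>. There a decreasing chain of four points
  cannot occur, and a convex increasing chain lies, up to its first point, on at most two lines
  through the origin; Ramsey's theorem finishes.

  In the irrational case, suppose that no \<open>N + 1\<close> points are in empty convex position. A long
  arithmetic progression of exponents along a good rational approximation of the ratio of
  logarithms would give such points, so the partial quotients are bounded by \<open>N\<close>. Then the best
  approximations from above, taken far enough out, log_ratio a concave chain which is again empty.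
\<close>

section \<open>Empty polygons as finite point sets\<close>

definition convex_empty :: "(real \<times> real) set \<Rightarrow> (real \<times> real) set \<Rightarrow> bool" where
  "convex_empty S V \<longleftrightarrow> finite V \<and> V \<subseteq> S \<and> convex hull V \<inter> S \<subseteq> V \<and>
     (\<forall>v\<in>V. v \<notin> convex hull (V - {v}))"

text \<open>By Minkowski's theorem the polytope is the hull of its extreme points. A vertex in the
  hull of the others could be dropped without changing the hull, and then it would not be
  extreme.\<close>

lemma convex_empty_polygon_vertices:
  assumes "empty_polygon S P"
  shows "convex_empty S (polygon_vertices P)"
proof -
  let ?V = "polygon_vertices P"
  have P: "polytope P" "?V \<subseteq> S" "P \<inter> S \<subseteq> ?V"
    using assms by (auto simp: empty_polygon_def convex_polygon_def)
  have hull: "P = convex hull ?V"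
    using Krein_Milman_Minkowski[of P] P(1)
    by (simp add: polygon_vertices_def polytope_imp_compact polytope_imp_convex)
  obtain W where W: "finite W" "P = convex hull W"
    using P(1) by (auto simp: polytope_def)
  have "?V \<subseteq> W"
    using extreme_points_of_convex_hull W(2) by (auto simp: polygon_vertices_def)
  then have fin: "finite ?V"
    using W(1) finite_subset by blast
  have "v \<notin> convex hull (?V - {v})" if "v \<in> ?V" for v
  proof
    assume v: "v \<in> convex hull (?V - {v})"
    have "v extreme_point_of (convex hull ?V)"
      using that hull by (auto simp: polygon_vertices_def)
    moreover have "convex hull ?V = convex hull (?V - {v})"
      using v that by (metis hull_redundant insert_Diff)
    ultimately have "v \<in> ?V - {v}"
      using extreme_point_of_convex_hull by metis
    then show False by blast
  qed
  then show ?thesis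
    using fin P hull unfolding convex_empty_def by auto
qed

text \<open>The basis of the comparison between lattices: hulls shrink with \<open>V\<close>, so
  emptiness and convex position both survive.\<close>

lemma convex_empty_subset:
  assumes "convex_empty S V" "T \<subseteq> S"
  shows "convex_empty T (V \<inter> T)"
  unfolding convex_empty_def
proof (intro conjI ballI)
  show "finite (V \<inter> T)" "V \<inter> T \<subseteq> T"
    using assms by (auto simp: convex_empty_def)
  show "convex hull (V \<inter> T) \<inter> T \<subseteq> V \<inter> T"
    using assms hull_mono[of "V \<inter> T" V convex] by (auto simp: convex_empty_def)
  fix v assume "v \<in> V \<inter> T"
  then show "v \<notin> convex hull (V \<inter> T - {v})"
    using assms hull_mono[of "V \<inter> T - {v}" "V - {v}" convex] by (fastforce simp: convex_empty_def)
qed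

lemma convex_empty_linear_image:
  assumes "linear f" "inj f" "convex_empty S V"
  shows "convex_empty (f ` S) (f ` V)"
  unfolding convex_empty_def
proof (intro conjI ballI)
  show "finite (f ` V)" "f ` V \<subseteq> f ` S"
    using assms by (auto simp: convex_empty_def)
  show "convex hull (f ` V) \<inter> f ` S \<subseteq> f ` V"
    using assms(3) image_Int[OF assms(2), of "convex hull V" S] image_mono[of "convex hull V \<inter> S" V f]
    unfolding convex_empty_def convex_hull_linear_image[OF assms(1), symmetric] by simp
  fix w assume "w \<in> f ` V"
  then obtain v where v: "v \<in> V" "w = f v" by blast
  have "f ` V - {w} = f ` (V - {v})"
    using v image_set_diff[OF assms(2), of V "{v}"] by simp
  then show "w \<notin> convex hull (f ` V - {w})"
    using assms(3) v inj_image_mem_iff[OF assms(2), of v]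
    by (auto simp: convex_empty_def convex_hull_linear_image[OF assms(1), symmetric])
qed

text \<open>The form in which configurations are refuted later. A lattice point of the triangle
  belongs to \<open>V\<close> by emptiness, and if it were not a corner it would lie in the hull of
  the other points of \<open>V\<close>.\<close>

lemma convex_empty_triangle:
  assumes "convex_empty S V" "a \<in> V" "b \<in> V" "c \<in> V" "q \<in> S" "q \<in> convex hull {a, b, c}"
  shows "q \<in> {a, b, c}"
proof (rule ccontr)
  assume q: "q \<notin> {a, b, c}"
  have "convex hull {a, b, c} \<subseteq> convex hull V"
    using assms by (intro hull_mono) auto
  then have "q \<in> V"
    using assms by (auto simp: convex_empty_def)
  moreover have "convex hull {a, b, c} \<subseteq> convex hull (V - {q})"
    using assms q by (intro hull_mono) auto
  ultimately show False
    using assms by (auto simp: convex_empty_def)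
qed

lemma convex_empty_segment:
  assumes "convex_empty S V" "a \<in> V" "b \<in> V" "c \<in> V" "b \<in> convex hull {a, c}"
  shows "b \<in> {a, c}"
proof -
  have "b \<in> S" using assms by (auto simp: convex_empty_def)
  then show ?thesis
    using convex_empty_triangle[of S V a c c b] assms by auto
qed

text \<open>Converse of \<open>convex_empty_polygon_vertices\<close>. Three points suffice for
  dimension two, since of three collinear points one lies between the other two, contrary to convex
  position.\<close>

lemma empty_polygon_convex_hull:
  assumes V: "convex_empty S V" and card: "card V \<ge> 3"
  shows "empty_polygon S (convex hull V)" "polygon_vertices (convex hull V) = V"
proof -
  have fin: "finite V" and ind: "\<And>v. v \<in> V \<Longrightarrow> v \<notin> convex hull (V - {v})"
    using V by (auto simp: convex_empty_def)
  show vert: "polygon_vertices (convex hull V) = V"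
  proof -
    have "v extreme_point_of (convex hull V) \<longleftrightarrow> v \<in> V" for v
      using extreme_point_of_convex_hull_convex_independent[of V v]
        ind fin finite_imp_compact by blast
    then show ?thesis by (auto simp: polygon_vertices_def)
  qed
  obtain T where T: "T \<subseteq> V" "card T = 3"
    by (rule obtain_subset_with_card_n[OF card])
  obtain a b c where "T = {a, b, c}" "a \<noteq> b" "a \<noteq> c" "b \<noteq> c"
    using T(2) unfolding card_3_iff by blast
  with T have abc: "a \<in> V" "b \<in> V" "c \<in> V" "a \<noteq> b" "a \<noteq> c" "b \<noteq> c"
    by blast+
  have "\<not> collinear {a, b, c}"
  proof
    assume "collinear {a, b, c}"
    then have "a \<in> convex hull {b, c} \<or> b \<in> convex hull {c, a} \<or> c \<in> convex hull {a, b}"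
      by (simp add: collinear_between_cases between_mem_convex_hull)
    then show False
      using convex_empty_segment[OF V, of b a c] convex_empty_segment[OF V, of c b a]
        convex_empty_segment[OF V, of a c b] abc by blast
  qed
  moreover have "{a, b, c} \<subseteq> convex hull V"
    using abc by (auto simp: hull_inc)
  ultimately have "\<not> collinear (convex hull V)"
    using collinear_subset by blast
  then have "aff_dim (convex hull V) = 2"
    using aff_dim_le_DIM[of "convex hull V"] by (simp add: collinear_aff_dim)
  then show "empty_polygon S (convex hull V)"
    using V fin vert by (auto simp: empty_polygon_def convex_polygon_def polytope_def convex_empty_def)
qed

lemma convex_hull_halfplane_le:
  fixes W :: "(real \<times> real) set"
  assumes "z \<in> convex hull W" "\<And>w. w \<in> W \<Longrightarrow> a * fst w + b * snd w \<le> c"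
  shows "a * fst z + b * snd z \<le> c"
proof -
  have eq: "{x. (a, b) \<bullet> x \<le> c} = {x. a * fst x + b * snd x \<le> c}"
    by (auto simp: inner_prod_def)
  have "convex hull W \<subseteq> {x. a * fst x + b * snd x \<le> c}"
    using assms(2) convex_halfspace_le[of "(a, b)" c] by (intro hull_minimal) (auto simp: eq)
  then show ?thesis using assms(1) by auto
qed

lemma convex_hull_halfplane_less:
  fixes W :: "(real \<times> real) set"
  assumes "z \<in> convex hull W" "\<And>w. w \<in> W \<Longrightarrow> a * fst w + b * snd w < c"
  shows "a * fst z + b * snd z < c"
proof -
  have eq: "{x. (a, b) \<bullet> x < c} = {x. a * fst x + b * snd x < c}"
    by (auto simp: inner_prod_def)
  have "convex hull W \<subseteq> {x. a * fst x + b * snd x < c}"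
    using assms(2) convex_halfspace_lt[of "(a, b)" c] by (intro hull_minimal) (auto simp: eq)
  then show ?thesis using assms(1) by auto
qed

section \<open>Symmetry, sublattices and scaling of the exponential lattice\<close>

lemma mem_exp_lattice_iff:
  "z \<in> exp_lattice \<alpha> \<beta> \<longleftrightarrow> (\<exists>m n. z = (\<alpha> ^ m, \<beta> ^ n))"
  unfolding exp_lattice_def by blast

lemma swap_linear: "linear (prod.swap :: real \<times> real \<Rightarrow> real \<times> real)"
  by (rule linearI) auto

lemma convex_empty_swap:
  assumes "convex_empty (exp_lattice \<alpha> \<beta>) V"
  shows "convex_empty (exp_lattice \<beta> \<alpha>) (prod.swap ` V)"
proof -
  have eq: "prod.swap ` exp_lattice \<alpha> \<beta> = exp_lattice \<beta> \<alpha>"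
    unfolding exp_lattice_def by (rule product_swap)
  have "inj (prod.swap :: real \<times> real \<Rightarrow> real \<times> real)"
    by (rule inj_swap)
  then show ?thesis
    using convex_empty_linear_image[OF swap_linear _ assms] unfolding eq by blast
qed

text \<open>An example with four vertices, which bounds \<open>max_empty_polygon\<close> from below
  by 4.\<close>

lemma convex_empty_square:
  assumes "\<alpha> > 1" "\<beta> > 1"
  shows "convex_empty (exp_lattice \<alpha> \<beta>) ({1, \<alpha>} \<times> {1, \<beta>})"
  (is "convex_empty ?L ?V")
  unfolding convex_empty_def
proof (intro conjI ballI)
  have "c ^ 0 \<in> range (\<lambda>n. c ^ n)" "c ^ 1 \<in> range (\<lambda>n. c ^ n)" for c :: real
    by (rule rangeI)+
  then have "{1, c} \<subseteq> range (\<lambda>n. c ^ n)" for c :: real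
    unfolding power_0 power_one_right by blast
  then show "?V \<subseteq> ?L"
    unfolding exp_lattice_def by (intro Sigma_mono)
  have base: "c ^ n = 1 \<or> c ^ n = c" if "c > 1" "c ^ n \<le> c" for c :: real and n
  proof -
    have "n \<le> 1"
      using that power_increasing_iff[of c n 1] by simp
    then show ?thesis by (cases n) auto
  qed
  show "convex hull ?V \<inter> ?L \<subseteq> ?V"
  proof
    fix z assume z: "z \<in> convex hull ?V \<inter> ?L"
    then obtain m n where mn: "z = (\<alpha> ^ m, \<beta> ^ n)" by (auto simp: exp_lattice_def)
    have "1 * fst z + 0 * snd z \<le> \<alpha>" "0 * fst z + 1 * snd z \<le> \<beta>"
      using z assms by (intro convex_hull_halfplane_le[of z ?V]; auto)+
    then show "z \<in> ?V"
      using base[of \<alpha> m] base[of \<beta> n] assms mn by auto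
  qed
  fix v assume v: "v \<in> ?V"
  show "v \<notin> convex hull (?V - {v})"
  proof
    assume h: "v \<in> convex hull (?V - {v})"
    \<comment> \<open>The factor is the offset of a coordinate from the midpoint of its two values.
      The functional with these coefficients points from the centre of the rectangle to the corner
      \<open>v\<close> and is maximal at \<open>v\<close> alone.\<close>
    have side: "(p - (1 + c) / 2) * w < (p - (1 + c) / 2) * p \<or> w = p"
      if "c > 1" "p \<in> {1, c}" "w \<in> {1, c}" for p w c :: real
    proof (cases "w = p")
      case False
      have "(c - 1) * (c - 1) > 0" using that by simp
      then show ?thesis using that False by (auto simp: field_simps)
    qed simp
    define a where "a = fst v - (1 + \<alpha>) / 2"
    define b where "b = snd v - (1 + \<beta>) / 2"
    have "a * fst v + b * snd v < a * fst v + b * snd v"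
    proof (rule convex_hull_halfplane_less[OF h])
      fix w assume "w \<in> ?V - {v}"
      then have w: "fst w \<in> {1, \<alpha>}" "snd w \<in> {1, \<beta>}" "w \<noteq> v"
        by auto
      have "a * fst w < a * fst v \<or> fst w = fst v" "b * snd w < b * snd v \<or> snd w = snd v"
        using side[OF assms(1), of "fst v" "fst w"] side[OF assms(2), of "snd v" "snd w"] v w
        unfolding a_def b_def by (auto simp: mem_Times_iff)
      then show "a * fst w + b * snd w < a * fst v + b * snd v"
        using w(3) by (smt (verit) prod_eqI)
    qed
    then show False by simp
  qed
qed simp

text \<open>Sets with fewer than three points span no polygon; for them the bound comes from the
  four vertices of the rectangle.\<close>

lemma convex_empty_card_le:
  assumes "\<alpha> > 1" "\<beta> > 1" "convex_empty (exp_lattice \<alpha> \<beta>) V"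
  shows "enat (card V) \<le> max_empty_polygon (exp_lattice \<alpha> \<beta>)"
proof -
  have ge: "enat (card W) \<le> max_empty_polygon (exp_lattice \<alpha> \<beta>)"
    if "convex_empty (exp_lattice \<alpha> \<beta>) W" "card W \<ge> 3" for W
    unfolding max_empty_polygon_def using empty_polygon_convex_hull[OF that]
    by (intro SUP_upper2[of "convex hull W"]) auto
  have "card ({1, \<alpha>} \<times> {1, \<beta>}) = 4"
    using assms by (simp add: card_cartesian_product)
  then have "enat 4 \<le> max_empty_polygon (exp_lattice \<alpha> \<beta>)"
    using ge[OF convex_empty_square[OF assms(1,2)]] by simp
  then show ?thesis
    using ge[OF assms(3)] order_trans[of "enat (card V)" "enat 4"] by (cases "card V \<ge> 3") auto
qed


text \<open>Division of both exponents with remainder: the remainders select one of the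
  \<open>k * l\<close> scaled copies.\<close>

lemma exp_lattice_cases:
  assumes "z \<in> exp_lattice \<alpha> \<beta>" "k \<ge> 1" "l \<ge> 1"
  obtains i j where "i < k" "j < l"
    "z \<in> (\<lambda>(x, y). (\<alpha> ^ i * x, \<beta> ^ j * y)) ` exp_lattice (\<alpha> ^ k) (\<beta> ^ l)"
proof -
  obtain m n where z: "z = (\<alpha> ^ m, \<beta> ^ n)"
    using assms(1) by (auto simp: exp_lattice_def)
  have "\<alpha> ^ m = \<alpha> ^ (m mod k) * (\<alpha> ^ k) ^ (m div k)" "\<beta> ^ n = \<beta> ^ (n mod l) * (\<beta> ^ l) ^ (n div l)"
    by (simp_all flip: power_mult power_add)
  then have "z \<in> (\<lambda>(x, y). (\<alpha> ^ (m mod k) * x, \<beta> ^ (n mod l) * y)) ` exp_lattice (\<alpha> ^ k) (\<beta> ^ l)"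
    by (intro image_eqI[of _ _ "((\<alpha> ^ k) ^ (m div k), (\<beta> ^ l) ^ (n div l))"])
      (auto simp: z exp_lattice_def)
  then show ?thesis
    using that[of "m mod k" "n mod l"] assms by simp
qed

lemma scaled_exp_lattice_subset:
  "(\<lambda>(x, y). (\<alpha> ^ i * x, \<beta> ^ j * y)) ` exp_lattice (\<alpha> ^ k) (\<beta> ^ l) \<subseteq> exp_lattice \<alpha> \<beta>"
proof -
  have "c ^ i * (c ^ k) ^ n \<in> range (\<lambda>n. c ^ n)" for c :: real and i k n
    using rangeI[of "\<lambda>n. c ^ n" "i + k * n"] by (simp add: power_add power_mult)
  then show ?thesis
    by (auto simp: exp_lattice_def)
qed

lemma convex_empty_scale:
  assumes "a > 0" "b > 0" "convex_empty ((\<lambda>(x, y). (a * x, b * y)) ` S) V"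
  obtains W where "convex_empty S W" "card W = card V"
proof
  define f :: "real \<times> real \<Rightarrow> real \<times> real" where "f = (\<lambda>(x, y). (x / a, y / b))"
  have "linear f"
    by (rule linearI) (auto simp: f_def add_divide_distrib)
  moreover have inj: "inj f"
    using assms by (auto simp: f_def inj_on_def)
  ultimately have "convex_empty (f ` (\<lambda>(x, y). (a * x, b * y)) ` S) (f ` V)"
    using assms(3) by (rule convex_empty_linear_image)
  moreover have "f ` (\<lambda>(x, y). (a * x, b * y)) ` S = S"
    using assms by (force simp: f_def image_image case_prod_unfold)
  ultimately show "convex_empty S (f ` V)" by simp
  show "card (f ` V) = card V"
    using inj by (simp add: card_image inj_on_subset)
qed

lemma max_empty_polygon_le:
  assumes "\<And>V. convex_empty S V \<Longrightarrow> enat (card V) \<le> N"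
  shows "max_empty_polygon S \<le> N"
  unfolding max_empty_polygon_def using assms convex_empty_polygon_vertices by (intro SUP_least) auto

text \<open>The scaled copies cover the lattice. Each meets \<open>V\<close> in a set that is empty
  for this copy, and scaling back bounds its size by the value for the sparser lattice.\<close>

lemma max_empty_polygon_power_le:
  assumes "\<alpha> > 1" "\<beta> > 1" "k \<ge> 1" "l \<ge> 1"
  shows "max_empty_polygon (exp_lattice \<alpha> \<beta>)
    \<le> enat (k * l) * max_empty_polygon (exp_lattice (\<alpha> ^ k) (\<beta> ^ l))"
proof (rule max_empty_polygon_le)
  fix V assume V: "convex_empty (exp_lattice \<alpha> \<beta>) V"
  define H where "H = max_empty_polygon (exp_lattice (\<alpha> ^ k) (\<beta> ^ l))"
  define T where "T = (\<lambda>(i, j). (\<lambda>(x, y). (\<alpha> ^ i * x, \<beta> ^ j * y)) ` exp_lattice (\<alpha> ^ k) (\<beta> ^ l))"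
  have fin: "finite V" and sub: "V \<subseteq> exp_lattice \<alpha> \<beta>"
    using V by (auto simp: convex_empty_def)
  have part: "enat (card (V \<inter> T p)) \<le> H" for p
  proof -
    obtain i j where p: "p = (i, j)" by (cases p)
    have "convex_empty (T p) (V \<inter> T p)"
      using convex_empty_subset[OF V scaled_exp_lattice_subset] by (simp add: T_def p)
    then obtain W where "convex_empty (exp_lattice (\<alpha> ^ k) (\<beta> ^ l)) W" "card W = card (V \<inter> T p)"
      using assms convex_empty_scale[of "\<alpha> ^ i" "\<beta> ^ j"] by (auto simp: T_def p)
    then show ?thesis
      using convex_empty_card_le[of "\<alpha> ^ k" "\<beta> ^ l" W] assms by (simp add: H_def)
  qed
  have "V \<subseteq> (\<Union>p\<in>{..<k} \<times> {..<l}. V \<inter> T p)"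
  proof
    fix z assume "z \<in> V"
    moreover from this have "z \<in> exp_lattice \<alpha> \<beta>"
      using sub by blast
    then obtain i j where "i < k" "j < l" "z \<in> T (i, j)"
      unfolding T_def prod.case by (rule exp_lattice_cases[OF _ assms(3,4)])
    ultimately show "z \<in> (\<Union>p\<in>{..<k} \<times> {..<l}. V \<inter> T p)"
      by blast
  qed
  then have "card V \<le> card (\<Union>p\<in>{..<k} \<times> {..<l}. V \<inter> T p)"
    using fin by (intro card_mono) auto
  also have "\<dots> \<le> (\<Sum>p\<in>{..<k} \<times> {..<l}. card (V \<inter> T p))"
    by (rule card_UN_le) auto
  finally have card: "card V \<le> (\<Sum>p\<in>{..<k} \<times> {..<l}. card (V \<inter> T p))" .
  show "enat (card V) \<le> enat (k * l) * max_empty_polygon (exp_lattice (\<alpha> ^ k) (\<beta> ^ l))"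
  proof (cases H)
    case (enat h)
    have "(\<Sum>p\<in>{..<k} \<times> {..<l}. card (V \<inter> T p)) \<le> (\<Sum>p\<in>{..<k} \<times> {..<l}. h)"
      using part by (intro sum_mono) (simp add: enat)
    then have "card V \<le> k * l * h"
      using card by simp
    then show ?thesis
      using enat unfolding H_def by simp
  next
    \<comment> \<open>In \<open>enat\<close> zero times infinity is zero, so \<open>k\<close> and
      \<open>l\<close> must be positive here.\<close>
    case infinity
    then show ?thesis
      using assms unfolding H_def by (simp add: enat_0_iff)
  qed
qed

subsection \<open>Points on a hyperbola\<close>

lemma sum_le_one_plus_mult:
  fixes x y :: real
  assumes "x \<ge> 1" "y \<ge> 1"
  shows "x + y \<le> 1 + x * y"
proof -
  have "(x - 1) * (y - 1) \<ge> 0" using assms by simp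
  then show ?thesis by (simp add: algebra_simps)
qed

text \<open>Bernoulli's lower bound for the exponent \<open>m + 1\<close> still exceeds the
  \<open>m\<close>th power: in
  \<open>(1 + e) ^ m \<le> exp (m * e) \<le> 1 + m * e + (m * e) ^ 2\<close> the hypothesis makes
  the quadratic term smaller than \<open>e\<close>.\<close>

lemma power_less_linear:
  fixes e :: real
  assumes "e > 0" "real m ^ 2 * e < 1"
  shows "(1 + e) ^ m < 1 + (real m + 1) * e"
proof (cases "m = 0")
  case False
  have "real m * e \<le> real m ^ 2 * e"
    using assms(1) False by (simp add: power2_eq_square)
  then have me: "real m * e < 1" using assms by linarith
  have "(1 + e) ^ m \<le> exp e ^ m"
    using assms by (intro power_mono) auto
  also have "\<dots> = exp (real m * e)"
    by (simp add: exp_of_nat_mult)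
  also have "\<dots> \<le> 1 + real m * e + (real m * e)\<^sup>2"
    using me assms by (intro exp_bound) auto
  also have "(real m * e)\<^sup>2 = (real m ^ 2 * e) * e"
    by (simp add: power2_eq_square)
  also have "\<dots> < 1 * e"
    using assms by (intro mult_strict_right_mono) auto
  finally show ?thesis by (simp add: algebra_simps)
qed (use assms in auto)

text \<open>When the product of two convex combinations is expanded, only the mixed term needs an
  argument: \<open>x * y' + x' * y \<ge> 2 * c\<close> by the inequality of arithmetic and geometric
  means.\<close>

lemma convex_quadrant_hyperbola:
  fixes c :: real
  assumes "c \<ge> 0"
  shows "convex {z :: real \<times> real. fst z > 0 \<and> snd z > 0 \<and> c \<le> fst z * snd z}"
proof (rule convexI, clarsimp)
  fix x y x' y' u v :: real
  assume h: "0 < x" "0 < y" "c \<le> x * y" "0 < x'" "0 < y'" "c \<le> x' * y'" "0 \<le> u" "0 \<le> v" "u + v = 1"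
  have pos: "u * p + v * q > 0" if "p > 0" "q > 0" for p q
    using that h by (cases "u = 0") (auto intro!: add_pos_nonneg)
  have "c * c \<le> (x * y) * (x' * y')"
    using h assms by (intro mult_mono) auto
  also have "\<dots> = (x * y') * (x' * y)" by simp
  also have "\<dots> * 4 \<le> (x * y' + x' * y)\<^sup>2"
    using zero_le_power2[of "x * y' - x' * y"] by (simp add: power2_eq_square algebra_simps)
  finally have "(2 * c)\<^sup>2 \<le> (x * y' + x' * y)\<^sup>2"
    by (simp add: power2_eq_square)
  then have "2 * c \<le> x * y' + x' * y"
    by (rule power2_le_imp_le) (use h in simp)
  then have "u * v * (2 * c) \<le> u * v * (x * y' + x' * y)"
    using h by (intro mult_left_mono) auto
  moreover have "u * u * c \<le> u * u * (x * y)" "v * v * c \<le> v * v * (x' * y')"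
    using h by (auto intro!: mult_left_mono)
  moreover have "c = (u + v) * (u + v) * c"
    using h by simp
  ultimately have "c \<le> (u * x + v * x') * (u * y + v * y')"
    by (simp add: algebra_simps)
  then show "0 < u * x + v * x' \<and> 0 < u * y + v * y' \<and> c \<le> (u * x + v * x') * (u * y + v * y')"
    using pos h by auto
qed

text \<open>The points have exponent sum \<open>m\<close>. A lattice point of the hull has exponent
  sum at least \<open>m\<close>, because the region above the hyperbola is convex, and less than
  \<open>m + 1\<close>, because it lies below the chord between the end points.\<close>

lemma convex_empty_hyperbola:
  fixes \<delta> :: real
  assumes "\<delta> > 1" "real m ^ 2 * (\<delta> - 1) < 1"
  shows "convex_empty (exp_lattice \<delta> \<delta>) ((\<lambda>i. (\<delta> ^ i, \<delta> ^ (m - i))) ` {..m})"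
    (is "convex_empty ?L ?V")
  unfolding convex_empty_def
proof (intro conjI ballI)
  show "?V \<subseteq> ?L"
    by (auto simp: exp_lattice_def)
  show "convex hull ?V \<inter> ?L \<subseteq> ?V"
  proof
    fix z assume z: "z \<in> convex hull ?V \<inter> ?L"
    then obtain a b where ab: "z = (\<delta> ^ a, \<delta> ^ b)" by (auto simp: exp_lattice_def)
    have "convex hull ?V \<subseteq> {z. fst z > 0 \<and> snd z > 0 \<and> \<delta> ^ m \<le> fst z * snd z}"
      using assms(1) by (intro hull_minimal convex_quadrant_hyperbola) (auto simp flip: power_add)
    then have "\<delta> ^ m \<le> \<delta> ^ (a + b)"
      using z ab by (auto simp: power_add)
    then have ge: "m \<le> a + b"
      using assms(1) power_increasing_iff by blast
    \<comment> \<open>The bounding line joins the two end points \<open>(1, \<delta> ^ m)\<close>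
      and \<open>(\<delta> ^ m, 1)\<close>.\<close>
    have "1 * fst z + 1 * snd z \<le> 1 + \<delta> ^ m"
    proof (rule convex_hull_halfplane_le)
      show "z \<in> convex hull ?V" using z by blast
      fix w assume "w \<in> ?V"
      then obtain i where "i \<le> m" "w = (\<delta> ^ i, \<delta> ^ (m - i))" by auto
      then show "1 * fst w + 1 * snd w \<le> 1 + \<delta> ^ m"
        using sum_le_one_plus_mult[of "\<delta> ^ i" "\<delta> ^ (m - i)"] assms(1) by (simp flip: power_add)
    qed
    moreover have "1 + real a * (\<delta> - 1) \<le> \<delta> ^ a" "1 + real b * (\<delta> - 1) \<le> \<delta> ^ b"
      using Bernoulli_inequality[of "\<delta> - 1"] assms(1) by auto
    moreover have "\<delta> ^ m < 1 + (real m + 1) * (\<delta> - 1)"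
      using power_less_linear[of "\<delta> - 1" m] assms by simp
    ultimately have "(real a + real b) * (\<delta> - 1) < (real m + 1) * (\<delta> - 1)"
      by (simp add: ab algebra_simps)
    then have "real a + real b < real m + 1"
      using assms(1) by simp
    then have "a + b = m" using ge by linarith
    then show "z \<in> ?V"
      using ab by (auto intro!: image_eqI[of _ _ a])
  qed
  fix v assume "v \<in> ?V"
  then obtain i where i: "i \<le> m" "v = (\<delta> ^ i, \<delta> ^ (m - i))" by auto
  show "v \<notin> convex hull (?V - {v})"
  proof
    assume h: "v \<in> convex hull (?V - {v})"
    \<comment> \<open>the tangent to the hyperbola at \<open>v\<close> separates\<close>
    have "- snd v * fst v + - fst v * snd v < - (2 * \<delta> ^ m)"
    proof (rule convex_hull_halfplane_less[OF h])
      fix w assume w: "w \<in> ?V - {v}"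
      then obtain j where j: "j \<le> m" "w = (\<delta> ^ j, \<delta> ^ (m - j))" by auto
      \<comment> \<open>\<open>s\<close> and \<open>t\<close> have the fixed product
        \<open>\<delta> ^ m * \<delta> ^ m\<close>, so the separation is the strict inequality of
        arithmetic and geometric means; equality would force \<open>w = v\<close>.\<close>
      define s where "s = snd v * fst w"
      define t where "t = fst v * snd w"
      have prod: "fst v * snd v = \<delta> ^ m" "fst w * snd w = \<delta> ^ m"
        using i j by (simp_all flip: power_add)
      have st: "s * t = \<delta> ^ m * \<delta> ^ m"
      proof -
        have "s * t = (fst v * snd v) * (fst w * snd w)" by (simp add: s_def t_def)
        then show ?thesis by (simp add: prod)
      qed
      have "s \<noteq> \<delta> ^ m"
      proof
        assume "s = \<delta> ^ m"
        then have "snd v * fst w = snd v * fst v" by (simp add: s_def prod(1)[symmetric])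
        then have "i = j" using i j assms(1) by simp
        then show False using w i j by simp
      qed
      then have "s \<noteq> t"
        using st i j assms(1) by (metis s_def t_def abs_of_pos mult_pos_pos prod.sel power2_eq_square
            power2_eq_imp_eq less_imp_le zero_less_power less_trans zero_less_one)
      then have "(s - t)\<^sup>2 > 0" by simp
      then have "(s + t)\<^sup>2 > (2 * \<delta> ^ m)\<^sup>2"
        using st by (simp add: power2_eq_square algebra_simps)
      moreover have "s + t \<ge> 0"
        using i j assms(1) by (simp add: s_def t_def)
      ultimately have "s + t > 2 * \<delta> ^ m"
        using power_less_imp_less_base by blast
      then show "- snd v * fst w + - fst v * snd w < - (2 * \<delta> ^ m)"
        by (simp add: s_def t_def)
    qed
    then show False
      using i by (simp flip: power_add)
  qed
qed simp

lemma max_empty_polygon_diagonal_ge: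
  fixes \<delta> :: real
  assumes "\<delta> > 1"
  shows "enat (nat \<lfloor>sqrt (1 / (\<delta> - 1))\<rfloor>) \<le> max_empty_polygon (exp_lattice \<delta> \<delta>)"
proof (cases "nat \<lfloor>sqrt (1 / (\<delta> - 1))\<rfloor>")
  \<comment> \<open>If the floor is \<open>m + 1\<close>, the exponents from 0 to \<open>m\<close>
    give just as many points, and passing from \<open>m + 1\<close> to \<open>m\<close> makes the
    bound on the square strict.\<close>
  case (Suc m)
  have "real (Suc m) \<le> sqrt (1 / (\<delta> - 1))"
    using Suc by linarith
  then have "real (Suc m) ^ 2 \<le> 1 / (\<delta> - 1)"
    using assms real_le_rsqrt[of ] by (metis of_nat_0_le_iff power_mono real_sqrt_pow2 divide_nonneg_nonneg zero_le_one diff_ge_0_iff_ge less_imp_le)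
  moreover have "real m ^ 2 < real (Suc m) ^ 2"
    by (intro power_strict_mono) auto
  ultimately have "real m ^ 2 < 1 / (\<delta> - 1)" by linarith
  then have "real m ^ 2 * (\<delta> - 1) < 1"
    using assms by (simp add: pos_less_divide_eq)
  then have "convex_empty (exp_lattice \<delta> \<delta>) ((\<lambda>i. (\<delta> ^ i, \<delta> ^ (m - i))) ` {..m})"
    using convex_empty_hyperbola assms by blast
  moreover have "card ((\<lambda>i. (\<delta> ^ i, \<delta> ^ (m - i))) ` {..m}) = Suc m"
    using assms by (subst card_image) (auto simp: inj_on_def)
  ultimately show ?thesis
    using convex_empty_card_le[of \<delta> \<delta>] assms Suc by metis
qed (simp flip: zero_enat_def)

subsection \<open>The lattice with equal bases\<close>

text \<open>Ramsey's theorem for symmetric relations instead of edge sets, with one \<open>r\<close>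
  for all sets and relations, so that it applies to comparisons of coordinates.\<close>

lemma ramsey_symmetric:
  "\<exists>r. \<forall>(V :: 'a set) P. finite V \<and> card V \<ge> r \<and> (\<forall>u v. P u v \<longrightarrow> P v u) \<longrightarrow>
    (\<exists>R \<subseteq> V. (card R = m \<and> (\<forall>u\<in>R. \<forall>v\<in>R. u \<noteq> v \<longrightarrow> P u v)) \<or>
             (card R = n \<and> (\<forall>u\<in>R. \<forall>v\<in>R. u \<noteq> v \<longrightarrow> \<not> P u v)))"
proof -
  obtain r where r: "\<And>(V :: 'a set) E. finite V \<Longrightarrow> card V \<ge> r \<Longrightarrow>
      \<exists>R \<subseteq> V. card R = m \<and> clique R E \<or> card R = n \<and> indep R E"
    using ramsey2[of m n] by meson
  show ?thesis
  proof (intro exI[of _ r] allI impI, elim conjE)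
    fix V :: "'a set" and P :: "'a \<Rightarrow> 'a \<Rightarrow> bool"
    assume V: "finite V" "r \<le> card V" and sym: "\<forall>u v. P u v \<longrightarrow> P v u"
    define E where "E = {{u, v} |u v. P u v}"
    have E: "{u, v} \<in> E \<longleftrightarrow> P u v" for u v
      using sym by (auto simp: E_def doubleton_eq_iff)
    obtain R where "R \<subseteq> V" "card R = m \<and> clique R E \<or> card R = n \<and> indep R E"
      using r[OF V] by blast
    then show "\<exists>R \<subseteq> V. (card R = m \<and> (\<forall>u\<in>R. \<forall>v\<in>R. u \<noteq> v \<longrightarrow> P u v)) \<or>
             (card R = n \<and> (\<forall>u\<in>R. \<forall>v\<in>R. u \<noteq> v \<longrightarrow> \<not> P u v))"
      unfolding clique_def indep_def E by blast
  qed
qed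

lemma obtain_increasing_enumeration:
  fixes f :: "'a \<Rightarrow> 'b :: linorder"
  assumes "finite R" "card R = n" "inj_on f R"
  obtains p where "\<And>i. i < n \<Longrightarrow> p i \<in> R" "\<And>i j. i < j \<Longrightarrow> j < n \<Longrightarrow> f (p i) < f (p j)"
proof -
  define xs where "xs = sorted_list_of_set (f ` R)"
  have xs: "strict_sorted xs" "set xs = f ` R" "length xs = n"
    using assms by (simp_all add: xs_def card_image)
  define p where "p i = inv_into R f (xs ! i)" for i
  have mem: "xs ! i \<in> f ` R" if "i < n" for i
    using that xs nth_mem by fastforce
  then have "p i \<in> R" "f (p i) = xs ! i" if "i < n" for i
    using that by (simp_all add: p_def inv_into_into f_inv_into_f)
  moreover have "xs ! i < xs ! j" if "i < j" "j < n" for i j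
    using that xs sorted_wrt_nth_less by metis
  ultimately show ?thesis
    using that by (metis order.strict_trans)
qed

section \<open>Lattice points in segments and triangles\<close>

lemma chord_point_in_segment:
  fixes a c :: "real \<times> real"
  assumes "fst a < fst c" "fst a \<le> x" "x \<le> fst c"
    and "(y - snd a) * (fst c - fst a) = (snd c - snd a) * (x - fst a)"
  shows "(x, y) \<in> convex hull {a, c}"
proof -
  define t where "t = (x - fst a) / (fst c - fst a)"
  have t: "0 \<le> t" "t \<le> 1" "t * (fst c - fst a) = x - fst a"
    using assms by (auto simp: t_def divide_simps)
  have "(t * (snd c - snd a)) * (fst c - fst a) = (y - snd a) * (fst c - fst a)"
    using assms(4) by (simp add: t(3)[symmetric] algebra_simps)
  then have "t * (snd c - snd a) = y - snd a"
    using assms(1) by simp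
  then have "(x, y) = (1 - t) *\<^sub>R a + t *\<^sub>R c"
    using t(3) by (intro prod_eqI) (auto simp: algebra_simps)
  then show ?thesis
    using t unfolding segment_convex_hull[symmetric] closed_segment_def by blast
qed

text \<open>The vertical segment from \<open>b\<close> up to the chord from \<open>a\<close> to
  \<open>c\<close> stays in the triangle. The last hypothesis, with its denominator cleared, keeps
  \<open>y\<close> from rising above this chord.\<close>

lemma above_vertex_in_triangle:
  fixes a b c :: "real \<times> real"
  assumes "fst a < fst b" "fst b < fst c" "snd b \<le> y"
    and "(y - snd a) * (fst c - fst a) \<le> (snd c - snd a) * (fst b - fst a)"
  shows "(fst b, y) \<in> convex hull {a, b, c}"
proof -
  define z where "z = snd a + (snd c - snd a) * (fst b - fst a) / (fst c - fst a)"
  have z: "(z - snd a) * (fst c - fst a) = (snd c - snd a) * (fst b - fst a)"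
    using assms by (simp add: z_def)
  then have "(fst b, z) \<in> convex hull {a, c}"
    using assms by (intro chord_point_in_segment) auto
  then have zin: "(fst b, z) \<in> convex hull {a, b, c}"
    using hull_mono[of "{a, c}" "{a, b, c}" convex] by blast
  have yz: "y \<le> z"
  proof -
    have "(y - snd a) * (fst c - fst a) \<le> (z - snd a) * (fst c - fst a)"
      using assms(4) z by simp
    then show ?thesis using assms(1,2) by simp
  qed
  have "(fst b, y) \<in> closed_segment b (fst b, z)"
  proof (cases "z = snd b")
    case True
    then have "(fst b, y) = b" using yz assms(3) by (simp add: prod_eq_iff)
    then show ?thesis by simp
  next
    case False
    define t where "t = (y - snd b) / (z - snd b)"
    have t: "0 \<le> t" "t \<le> 1" "t * (z - snd b) = y - snd b"
      using False yz assms(3) by (auto simp: t_def divide_simps)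
    then have "(fst b, y) = (1 - t) *\<^sub>R b + t *\<^sub>R (fst b, z)"
      by (intro prod_eqI) (auto simp: algebra_simps)
    then show ?thesis using t unfolding closed_segment_def by blast
  qed
  moreover have "b \<in> convex hull {a, b, c}" by (simp add: hull_inc)
  ultimately show ?thesis
    using zin closed_segment_subset[OF _ zin convex_convex_hull] by blast
qed

lemma convex_empty_not_collinear:
  assumes "convex_empty S V" "a \<in> V" "b \<in> V" "c \<in> V" "fst a < fst b" "fst b < fst c"
  shows "(snd b - snd a) * (fst c - fst a) \<noteq> (snd c - snd a) * (fst b - fst a)"
proof
  assume "(snd b - snd a) * (fst c - fst a) = (snd c - snd a) * (fst b - fst a)"
  then have "(fst b, snd b) \<in> convex hull {a, c}"
    using assms by (intro chord_point_in_segment) auto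
  then show False
    using convex_empty_segment[OF assms(1-4)] assms(5,6) by auto
qed

text \<open>Of three points on a vertical line, the middle one lies in the hull of the others. The
  condition on distinct pairs has the shape of a Ramsey alternative.\<close>

lemma convex_empty_same_fst:
  assumes "convex_empty S V" "T \<subseteq> V" "\<forall>u\<in>T. \<forall>v\<in>T. u \<noteq> v \<longrightarrow> fst u = fst v"
  shows "card T \<noteq> 3"
proof
  assume T: "card T = 3"
  then have fin: "finite T" using card.infinite by fastforce
  have "inj_on snd T"
    using assms(3) unfolding inj_on_def by (metis prod_eqI)
  then obtain p :: "nat \<Rightarrow> real \<times> real" where p: "\<And>i. i < 3 \<Longrightarrow> p i \<in> T" "\<And>i j. i < j \<Longrightarrow> j < 3 \<Longrightarrow> snd (p i) < snd (p j)"
    using obtain_increasing_enumeration[OF fin T] by metis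
  define a b c where "a = p 0" "b = p 1" "c = p 2"
  have abc: "a \<in> T" "b \<in> T" "c \<in> T" "snd a < snd b" "snd b < snd c"
    using p by (simp_all add: a_b_c_def)
  have eq: "fst a = fst b" "fst c = fst b"
    using assms(3) abc by (metis less_irrefl)+
  define t where "t = (snd b - snd a) / (snd c - snd a)"
  have t: "0 \<le> t" "t \<le> 1" "t * (snd c - snd a) = snd b - snd a"
    using abc by (auto simp: t_def divide_simps)
  then have "b = (1 - t) *\<^sub>R a + t *\<^sub>R c"
    using eq by (intro prod_eqI) (auto simp: algebra_simps)
  then have "b \<in> convex hull {a, c}"
    using t unfolding segment_convex_hull[symmetric] closed_segment_def by blast
  then have "b \<in> {a, c}"
    using convex_empty_segment[OF assms(1)] abc assms(2) by blast
  then show False using abc by auto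
qed

lemma convex_empty_same_snd:
  assumes "convex_empty (exp_lattice \<gamma> \<gamma>) V" "T \<subseteq> V" "\<forall>u\<in>T. \<forall>v\<in>T. u \<noteq> v \<longrightarrow> snd u = snd v"
  shows "card T \<noteq> 3"
proof -
  have "card (prod.swap ` T) \<noteq> 3"
    using assms(2,3) by (intro convex_empty_same_fst[OF convex_empty_swap[OF assms(1)]]) auto
  then show ?thesis by (simp add: card_image)
qed

section \<open>Monotone chains for a base of at least 4\<close>

text \<open>The place where \<open>\<gamma> \<ge> 4\<close> enters: a difference of two distinct
  powers is at least three quarters of the larger one.\<close>

lemma power_gap_bounds:
  fixes \<gamma> :: real
  assumes "\<gamma> \<ge> 4" "a < b"
  shows "\<gamma> ^ a \<le> \<gamma> ^ b / 4" "0 < \<gamma> ^ a"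
proof -
  have "\<gamma> ^ a * 4 \<le> \<gamma> ^ a * \<gamma>" using assms by (intro mult_left_mono) auto
  also have "\<dots> = \<gamma> ^ Suc a" by simp
  also have "\<dots> \<le> \<gamma> ^ b" using assms by (intro power_increasing) auto
  finally show "\<gamma> ^ a \<le> \<gamma> ^ b / 4" by simp
  show "0 < \<gamma> ^ a" using assms by simp
qed

text \<open>The lattice point in the column of \<open>p3\<close> and the row of \<open>p2\<close>
  lies above \<open>p3\<close> and below the chord from \<open>p1\<close> to \<open>p4\<close>,
  because \<open>1 / 4 \<le> (3 / 4) * (3 / 4)\<close>. Hence it lies in the triangle
  \<open>p1\<close>, \<open>p3\<close>, \<open>p4\<close>.\<close>

lemma convex_empty_no_decreasing_chain:
  assumes \<gamma>: "\<gamma> \<ge> 4" and V: "convex_empty (exp_lattice \<gamma> \<gamma>) V"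
    and p: "p1 \<in> V" "p2 \<in> V" "p3 \<in> V" "p4 \<in> V"
    and x: "fst p1 < fst p2" "fst p2 < fst p3" "fst p3 < fst p4"
    and y: "snd p1 > snd p2" "snd p2 > snd p3" "snd p3 > snd p4"
  shows False
proof -
  have lat: "\<exists>a b. v = (\<gamma> ^ a, \<gamma> ^ b)" if "v \<in> V" for v
    using V that unfolding convex_empty_def mem_exp_lattice_iff[symmetric] by blast
  obtain a1 b1 a2 b2 a3 b3 a4 b4 where pe: "p1 = (\<gamma> ^ a1, \<gamma> ^ b1)" "p2 = (\<gamma> ^ a2, \<gamma> ^ b2)"
      "p3 = (\<gamma> ^ a3, \<gamma> ^ b3)" "p4 = (\<gamma> ^ a4, \<gamma> ^ b4)"
    using p[THEN lat] by blast
  have exps: "a1 < a2" "a2 < a3" "a3 < a4" "b2 < b1" "b3 < b2" "b4 < b3"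
    using x y \<gamma> by (simp_all add: pe)
  have "(\<gamma> ^ b1 - \<gamma> ^ b4) * (\<gamma> ^ a3 - \<gamma> ^ a1) \<le> \<gamma> ^ b1 * (\<gamma> ^ a4 / 4)"
    using power_gap_bounds[OF \<gamma> exps(1)] power_gap_bounds[OF \<gamma> exps(2)]
      power_gap_bounds[OF \<gamma> exps(3)] power_gap_bounds[OF \<gamma> exps(4)]
      power_gap_bounds[OF \<gamma> exps(5)] power_gap_bounds[OF \<gamma> exps(6)]
    by (intro mult_mono; linarith)
  also have "\<dots> \<le> (3 / 4 * \<gamma> ^ b1) * (3 / 4 * \<gamma> ^ a4)"
    using \<gamma> by simp
  also have "\<dots> \<le> (\<gamma> ^ b1 - \<gamma> ^ b2) * (\<gamma> ^ a4 - \<gamma> ^ a1)"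
    using \<gamma> exps power_gap_bounds[OF \<gamma>, of b2 b1] power_gap_bounds[OF \<gamma>, of a1 a4]
    by (intro mult_mono) auto
  finally have "(fst p3, \<gamma> ^ b2) \<in> convex hull {p1, p3, p4}"
    using x y by (intro above_vertex_in_triangle) (auto simp: pe algebra_simps)
  moreover have "(fst p3, \<gamma> ^ b2) \<in> exp_lattice \<gamma> \<gamma>"
    by (auto simp: pe exp_lattice_def)
  ultimately have "(fst p3, \<gamma> ^ b2) \<in> {p1, p3, p4}"
    using convex_empty_triangle[OF V p(1,3,4)] by blast
  then show False
    using x y by (auto simp: pe)
qed

text \<open>The offset \<open>b - a\<close> names the line through the origin that carries
  \<open>(\<gamma> ^ a, \<gamma> ^ b)\<close>; from \<open>u\<close> to \<open>v\<close> it grows by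
  0 or 1, written additively to avoid truncated subtraction. A decrease would contradict
  \<open>below\<close>, as it costs a factor 4 against 9/16. If it grew by 2 or more, the lattice
  point next above \<open>u\<close> would lie in the triangle \<open>p\<close>, \<open>u\<close>,
  \<open>v\<close>.\<close>

lemma convex_empty_convex_chain_exponents:
  assumes \<gamma>: "\<gamma> \<ge> 4" and V: "convex_empty (exp_lattice \<gamma> \<gamma>) V"
    and p: "p \<in> V" "u \<in> V" "v \<in> V"
    and pe: "p = (\<gamma> ^ a1, \<gamma> ^ b1)" "u = (\<gamma> ^ a2, \<gamma> ^ b2)" "v = (\<gamma> ^ a3, \<gamma> ^ b3)"
    and exps: "a1 < a2" "a2 < a3" "b1 < b2" "b2 < b3"
    and below: "(snd u - snd p) * (fst v - fst p) < (snd v - snd p) * (fst u - fst p)"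
  shows "b2 + a3 \<le> b3 + a2" "b3 + a2 \<le> b2 + a3 + 1"
proof -
  note g = power_gap_bounds[OF \<gamma>]
  have "(3 / 4 * \<gamma> ^ b2) * (3 / 4 * \<gamma> ^ a3) \<le> (\<gamma> ^ b2 - \<gamma> ^ b1) * (\<gamma> ^ a3 - \<gamma> ^ a1)"
    using \<gamma> exps g[of b1 b2] g[of a1 a3] by (intro mult_mono) auto
  also have "\<dots> < (\<gamma> ^ b3 - \<gamma> ^ b1) * (\<gamma> ^ a2 - \<gamma> ^ a1)"
    using below by (simp add: pe)
  also have "\<dots> \<le> \<gamma> ^ b3 * \<gamma> ^ a2"
    using \<gamma> exps by (intro mult_mono) auto
  finally have "9 / 16 * \<gamma> ^ (b2 + a3) < \<gamma> ^ (b3 + a2)"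
    by (simp add: power_add)
  moreover have "\<gamma> ^ (b3 + a2) \<le> \<gamma> ^ (b2 + a3) / 4" if "b3 + a2 < b2 + a3"
    using g that by blast
  moreover have "\<gamma> ^ (b2 + a3) > 0" using \<gamma> by simp
  ultimately show "b2 + a3 \<le> b3 + a2"
    by (cases "b3 + a2 < b2 + a3") auto
  show "b3 + a2 \<le> b2 + a3 + 1"
  proof (rule ccontr)
    assume "\<not> b3 + a2 \<le> b2 + a3 + 1"
    then have "\<gamma> ^ (b2 + 1 + a3) \<le> \<gamma> ^ (b3 + a2) / 4"
      using g[of "b2 + 1 + a3" "b3 + a2"] by simp
    moreover have "(\<gamma> ^ (b2 + 1) - \<gamma> ^ b1) * (\<gamma> ^ a3 - \<gamma> ^ a1) \<le> \<gamma> ^ (b2 + 1) * \<gamma> ^ a3"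
      using \<gamma> exps by (intro mult_mono) auto
    moreover have "(3 / 4 * \<gamma> ^ b3) * (3 / 4 * \<gamma> ^ a2) \<le> (\<gamma> ^ b3 - \<gamma> ^ b1) * (\<gamma> ^ a2 - \<gamma> ^ a1)"
      using \<gamma> exps g[of b1 b3] g[of a1 a2] by (intro mult_mono) auto
    moreover have "\<gamma> ^ (b3 + a2) / 4 \<le> (3 / 4 * \<gamma> ^ b3) * (3 / 4 * \<gamma> ^ a2)"
      using \<gamma> by (simp add: power_add)
    ultimately have "(\<gamma> ^ (b2 + 1) - \<gamma> ^ b1) * (\<gamma> ^ a3 - \<gamma> ^ a1) \<le> (\<gamma> ^ b3 - \<gamma> ^ b1) * (\<gamma> ^ a2 - \<gamma> ^ a1)"
      unfolding power_add[of \<gamma> "b2 + 1" a3] by linarith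
    then have "(fst u, \<gamma> ^ (b2 + 1)) \<in> convex hull {p, u, v}"
      using exps \<gamma> by (intro above_vertex_in_triangle) (auto simp: pe)
    moreover have "(fst u, \<gamma> ^ (b2 + 1)) \<in> exp_lattice \<gamma> \<gamma>"
      unfolding pe mem_exp_lattice_iff fst_conv by blast
    ultimately have "(fst u, \<gamma> ^ (b2 + 1)) \<in> {p, u, v}"
      using convex_empty_triangle[OF V p] by blast
    then show False
      using exps \<gamma> by (auto simp: pe)
  qed
qed

text \<open>Five points on at most two lines through the origin would leave three on one of them,
  which convex position forbids. The condition \<open>below\<close> says that slopes seen from
  \<open>p\<close> increase along the chain.\<close>

lemma convex_empty_convex_chain_card:
  assumes \<gamma>: "\<gamma> \<ge> 4" and V: "convex_empty (exp_lattice \<gamma> \<gamma>) V"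
    and p: "p \<in> V" and Q: "Q \<subseteq> V" "\<And>u. u \<in> Q \<Longrightarrow> fst p < fst u \<and> snd p < snd u"
    and incr: "\<And>u v. u \<in> Q \<Longrightarrow> v \<in> Q \<Longrightarrow> u \<noteq> v \<Longrightarrow> fst u < fst v \<and> snd u < snd v \<or> fst v < fst u \<and> snd v < snd u"
    and below: "\<And>u v. u \<in> Q \<Longrightarrow> v \<in> Q \<Longrightarrow> fst u < fst v \<Longrightarrow>
      (snd u - snd p) * (fst v - fst p) < (snd v - snd p) * (fst u - fst p)"
  shows "card Q \<noteq> 5"
proof
  assume card: "card Q = 5"
  then have fin: "finite Q" using card.infinite by fastforce
  have "inj_on fst Q"
    using incr unfolding inj_on_def by (metis less_irrefl)
  then obtain w :: "nat \<Rightarrow> real \<times> real" where w: "\<And>i. i < 5 \<Longrightarrow> w i \<in> Q" "\<And>i j. i < j \<Longrightarrow> j < 5 \<Longrightarrow> fst (w i) < fst (w j)"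
    using obtain_increasing_enumeration[OF fin card] by metis
  have lat: "\<exists>a b. v = (\<gamma> ^ a, \<gamma> ^ b)" if "v \<in> V" for v
    using V that unfolding convex_empty_def mem_exp_lattice_iff[symmetric] by blast
  obtain a0 b0 where p0: "p = (\<gamma> ^ a0, \<gamma> ^ b0)" using lat p by blast
  have "\<forall>i. \<exists>a b. i < 5 \<longrightarrow> w i = (\<gamma> ^ a, \<gamma> ^ b)"
    using lat w(1) Q(1) by blast
  then obtain a b :: "nat \<Rightarrow> nat" where ab: "\<And>i. i < 5 \<Longrightarrow> w i = (\<gamma> ^ a i, \<gamma> ^ b i)"
    by metis
  have \<gamma>1: "\<gamma> > 1" using \<gamma> by simp
  have exps: "a i < a j" "b i < b j" "a0 < a i" "b0 < b i" if "i < j" "j < 5" for i j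
  proof -
    have "fst (w i) < fst (w j)" "snd (w i) < snd (w j)"
      using w(2)[OF that] incr[OF w(1) w(1), of i j] that by fastforce+
    then show "a i < a j" "b i < b j" using ab that \<gamma>1 by simp_all
    show "a0 < a i" "b0 < b i"
      using Q(2)[OF w(1), of i] p0 ab that \<gamma>1 by simp_all
  qed
  have d: "b i + a j \<le> b j + a i" "b j + a i \<le> b i + a j + 1" if "i < j" "j < 5" for i j
  proof -
    have i: "i < 5" using that by simp
    have m: "w i \<in> V" "w j \<in> V" using w(1) i that Q(1) by blast+
    note * = convex_empty_convex_chain_exponents[OF \<gamma> V p m p0 ab[OF i] ab[OF that(2)]
        exps(3)[OF that] exps(1)[OF that] exps(4)[OF that] exps(2)[OF that]
        below[OF w(1)[OF i] w(1)[OF that(2)] w(2)[OF that]]]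
    show "b i + a j \<le> b j + a i" "b j + a i \<le> b i + a j + 1" by (fact *)+
  qed
  \<comment> \<open>\<open>b i - a i\<close> is nondecreasing and takes at most two values, hence one of them three times in a row\<close>
  have "\<exists>i j k. i < j \<and> j < k \<and> k < 5 \<and> b i + a j = b j + a i \<and> b j + a k = b k + a j"
  proof (cases "b 0 + a 2 = b 2 + a 0")
    case True
    then show ?thesis
      using d[of 0 1] d[of 1 2] by (intro exI[of _ 0] exI[of _ 1] exI[of _ 2]) simp
  next
    case False
    then show ?thesis
      using d[of 0 2] d[of 0 3] d[of 0 4] d[of 2 3] d[of 3 4] 
      by (intro exI[of _ 2] exI[of _ 3] exI[of _ 4]) simp
  qed
  then obtain i j k where ijk: "i < j" "j < k" "k < 5" "b i + a j = b j + a i" "b j + a k = b k + a j"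
    by blast
  have ik: "b i + a k = b k + a i" using ijk(4,5) by simp
  have m: "w i \<in> V" "w j \<in> V" "w k \<in> V" using w(1) ijk Q(1) by auto
  have "\<gamma> ^ b i * \<gamma> ^ a j = \<gamma> ^ b j * \<gamma> ^ a i" "\<gamma> ^ b j * \<gamma> ^ a k = \<gamma> ^ b k * \<gamma> ^ a j"
    "\<gamma> ^ b i * \<gamma> ^ a k = \<gamma> ^ b k * \<gamma> ^ a i"
    unfolding power_add[symmetric] ijk(4,5) ik by (rule refl)+
  then have "(snd (w j) - snd (w i)) * (fst (w k) - fst (w i)) = (snd (w k) - snd (w i)) * (fst (w j) - fst (w i))"
    using ab ijk by (simp add: algebra_simps)
  then show False
    using convex_empty_not_collinear[OF V m] w(2) ijk by simp
qed

text \<open>Four applications of Ramsey's theorem: they make all first coordinates distinct, then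
  all second ones, then the points a chain, and finally the slopes seen from its first point
  monotone. The Ramsey numbers are fixed in the reverse order.\<close>

lemma convex_empty_diagonal_bounded:
  assumes \<gamma>: "\<gamma> \<ge> 4"
  shows "\<exists>N. \<forall>V. convex_empty (exp_lattice \<gamma> \<gamma>) V \<longrightarrow> card V < N"
proof -
  let ?R = "\<lambda>r m n. \<forall>(V :: (real \<times> real) set) P. finite V \<and> card V \<ge> r \<and> (\<forall>u v. P u v \<longrightarrow> P v u) \<longrightarrow>
    (\<exists>R \<subseteq> V. (card R = m \<and> (\<forall>u\<in>R. \<forall>v\<in>R. u \<noteq> v \<longrightarrow> P u v)) \<or>
             (card R = n \<and> (\<forall>u\<in>R. \<forall>v\<in>R. u \<noteq> v \<longrightarrow> \<not> P u v)))"
  obtain r1 where r1: "?R r1 5 5" using ramsey_symmetric by blast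
  \<comment> \<open>The extra point is the leftmost point \<open>p\<close> of the increasing chain,
    which is set aside as base point.\<close>
  obtain r2 where r2: "?R r2 (Suc r1) 4" using ramsey_symmetric by blast
  obtain r3 where r3: "?R r3 3 r2" using ramsey_symmetric by blast
  obtain r4 where r4: "?R r4 3 r3" using ramsey_symmetric by blast
  have False if V: "convex_empty (exp_lattice \<gamma> \<gamma>) V" and card: "card V \<ge> r4" for V
  proof -
    have fin: "finite V" using V by (simp add: convex_empty_def)
    have "\<exists>R \<subseteq> V. (card R = 3 \<and> (\<forall>u\<in>R. \<forall>v\<in>R. u \<noteq> v \<longrightarrow> fst u = fst v)) \<or>
             (card R = r3 \<and> (\<forall>u\<in>R. \<forall>v\<in>R. u \<noteq> v \<longrightarrow> fst u \<noteq> fst v))"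
      using r4[rule_format, of V "\<lambda>u v. fst u = fst v"] fin card by simp
    then obtain A where A: "A \<subseteq> V" "card A = r3" "\<forall>u\<in>A. \<forall>v\<in>A. u \<noteq> v \<longrightarrow> fst u \<noteq> fst v"
      using convex_empty_same_fst[OF V] by blast
    have finA: "finite A" using A(1) fin finite_subset by blast
    have "\<exists>R \<subseteq> A. (card R = 3 \<and> (\<forall>u\<in>R. \<forall>v\<in>R. u \<noteq> v \<longrightarrow> snd u = snd v)) \<or>
             (card R = r2 \<and> (\<forall>u\<in>R. \<forall>v\<in>R. u \<noteq> v \<longrightarrow> snd u \<noteq> snd v))"
      using r3[rule_format, of A "\<lambda>u v. snd u = snd v"] finA A(2) by simp
    then obtain B where B: "B \<subseteq> A" "card B = r2" "\<forall>u\<in>B. \<forall>v\<in>B. u \<noteq> v \<longrightarrow> snd u \<noteq> snd v"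
      using convex_empty_same_snd[OF V] A(1) by (elim exE conjE disjE) (blast, metis)
    have finB: "finite B" using B(1) finA finite_subset by blast
    let ?I = "\<lambda>u v :: real \<times> real. fst u < fst v \<and> snd u < snd v \<or> fst v < fst u \<and> snd v < snd u"
    have "\<exists>R \<subseteq> B. (card R = Suc r1 \<and> (\<forall>u\<in>R. \<forall>v\<in>R. u \<noteq> v \<longrightarrow> ?I u v)) \<or>
             (card R = 4 \<and> (\<forall>u\<in>R. \<forall>v\<in>R. u \<noteq> v \<longrightarrow> \<not> ?I u v))"
      using r2[rule_format, of B ?I] finB B(2) by blast
    then obtain C where C: "C \<subseteq> B" and C2: "(card C = Suc r1 \<and> (\<forall>u\<in>C. \<forall>v\<in>C. u \<noteq> v \<longrightarrow> ?I u v)) \<or>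
             (card C = 4 \<and> (\<forall>u\<in>C. \<forall>v\<in>C. u \<noteq> v \<longrightarrow> \<not> ?I u v))" by blast
    have finC: "finite C" using C finB finite_subset by blast
    have CV: "C \<subseteq> V" using C B(1) A(1) by blast
    have dist: "fst u \<noteq> fst v" "snd u \<noteq> snd v" if "u \<in> C" "v \<in> C" "u \<noteq> v" for u v
      using that A(3) B(1,3) C by blast+
    have inj: "inj_on fst C"
      using dist unfolding inj_on_def by blast
    from C2 show False
    proof
      assume c: "card C = 4 \<and> (\<forall>u\<in>C. \<forall>v\<in>C. u \<noteq> v \<longrightarrow> \<not> ?I u v)"
      then obtain w :: "nat \<Rightarrow> real \<times> real" where w: "\<And>i. i < 4 \<Longrightarrow> w i \<in> C" "\<And>i j. i < j \<Longrightarrow> j < 4 \<Longrightarrow> fst (w i) < fst (w j)"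
        using obtain_increasing_enumeration[OF finC _ inj, of 4] by metis
      have "snd (w i) > snd (w j)" if "i < j" "j < 4" for i j
      proof -
        have ne: "w i \<noteq> w j" using w(2)[OF that] by auto
        have "w i \<in> C" "w j \<in> C" using w(1) that by auto
        then show ?thesis
          using c ne w(2)[OF that] dist(2)[of "w i" "w j"] by (meson linorder_neqE)
      qed
      moreover have "w i \<in> V" if "i < 4" for i
        using w(1) that CV by blast
      ultimately show False
        using convex_empty_no_decreasing_chain[OF \<gamma> V, of "w 0" "w 1" "w 2" "w 3"] w(2) by simp
    next
      assume c: "card C = Suc r1 \<and> (\<forall>u\<in>C. \<forall>v\<in>C. u \<noteq> v \<longrightarrow> ?I u v)"
      then have "C \<noteq> {}" by auto
      then obtain p where p: "p \<in> C" "\<And>u. u \<in> C \<Longrightarrow> fst p \<le> fst u"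
        using finC ex_min_if_finite[of "fst ` C"] by (metis (no_types, lifting) arg_min_if_finite(1) arg_min_least)
      define D where "D = C - {p}"
      have D: "card D = r1" "finite D" "D \<subseteq> V"
        using c p(1) finC CV by (auto simp: D_def)
      have I: "?I u v" if "u \<in> C" "v \<in> C" "u \<noteq> v" for u v
        using c that by blast
      have pD: "fst p < fst u \<and> snd p < snd u" if "u \<in> D" for u
      proof -
        have "u \<in> C" "p \<noteq> u" using that by (auto simp: D_def)
        then show ?thesis using I[of p u] p by fastforce
      qed
      let ?b = "\<lambda>u v. (snd u - snd p) * (fst v - fst p) < (snd v - snd p) * (fst u - fst p)"
      let ?B = "\<lambda>u v. fst u < fst v \<and> ?b u v \<or> fst v < fst u \<and> ?b v u"
      have "\<exists>R \<subseteq> D. (card R = 5 \<and> (\<forall>u\<in>R. \<forall>v\<in>R. u \<noteq> v \<longrightarrow> ?B u v)) \<or>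
             (card R = 5 \<and> (\<forall>u\<in>R. \<forall>v\<in>R. u \<noteq> v \<longrightarrow> \<not> ?B u v))"
        using r1[rule_format, of D ?B] D by blast
      then obtain Q where Q: "Q \<subseteq> D" "card Q = 5" and Q2: "(\<forall>u\<in>Q. \<forall>v\<in>Q. u \<noteq> v \<longrightarrow> ?B u v) \<or>
             (\<forall>u\<in>Q. \<forall>v\<in>Q. u \<noteq> v \<longrightarrow> \<not> ?B u v)" by blast
      have QC: "Q \<subseteq> C" using Q(1) by (auto simp: D_def)
      from Q2 show False
      proof
        assume b: "\<forall>u\<in>Q. \<forall>v\<in>Q. u \<noteq> v \<longrightarrow> ?B u v"
        have "card Q \<noteq> 5"
        proof (rule convex_empty_convex_chain_card[OF \<gamma> V])
          show "p \<in> V" "Q \<subseteq> V" using p CV QC by auto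
          show "fst p < fst u \<and> snd p < snd u" if "u \<in> Q" for u using pD Q that by blast
          show "?I u v" if "u \<in> Q" "v \<in> Q" "u \<noteq> v" for u v
            using I QC that by blast
          show "?b u v" if "u \<in> Q" "v \<in> Q" "fst u < fst v" for u v
            using b that by (metis less_asym less_irrefl)
        qed
        then show False using Q by blast
      next
        assume b: "\<forall>u\<in>Q. \<forall>v\<in>Q. u \<noteq> v \<longrightarrow> \<not> ?B u v"
        \<comment> \<open>Reflection in the diagonal turns a concave chain into a convex one; equal
          slopes are excluded by convex position.\<close>
        have "card (prod.swap ` Q) \<noteq> 5"
        proof (rule convex_empty_convex_chain_card[OF \<gamma> convex_empty_swap[OF V], of "prod.swap p"])
          show "prod.swap p \<in> prod.swap ` V" "prod.swap ` Q \<subseteq> prod.swap ` V" using p CV QC by auto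
          show "fst (prod.swap p) < fst u \<and> snd (prod.swap p) < snd u" if "u \<in> prod.swap ` Q" for u
            using pD Q that by auto
          show "?I u v" if "u \<in> prod.swap ` Q" "v \<in> prod.swap ` Q" "u \<noteq> v" for u v
          proof -
            obtain u' v' where uv: "u' \<in> Q" "v' \<in> Q" "u = prod.swap u'" "v = prod.swap v'"
              using \<open>u \<in> prod.swap ` Q\<close> \<open>v \<in> prod.swap ` Q\<close> by blast
            then have "?I u' v'" using I QC \<open>u \<noteq> v\<close> by blast
            then show ?thesis using uv by auto
          qed
          show "(snd u - snd (prod.swap p)) * (fst v - fst (prod.swap p)) < (snd v - snd (prod.swap p)) * (fst u - fst (prod.swap p))"
            if "u \<in> prod.swap ` Q" "v \<in> prod.swap ` Q" "fst u < fst v" for u v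
          proof -
            obtain u' v' where uv: "u' \<in> Q" "v' \<in> Q" "u = prod.swap u'" "v = prod.swap v'"
              using \<open>u \<in> prod.swap ` Q\<close> \<open>v \<in> prod.swap ` Q\<close> by blast
            have ne: "u' \<noteq> v'" using \<open>fst u < fst v\<close> uv by auto
            then have lt: "fst u' < fst v'"
              using I[of u' v'] QC uv \<open>fst u < fst v\<close> by auto
            have "\<not> ?b u' v'" using b uv ne lt by blast
            moreover have "(snd u' - snd p) * (fst v' - fst p) \<noteq> (snd v' - snd p) * (fst u' - fst p)"
              using convex_empty_not_collinear[OF V, of p u' v'] p(1) uv QC CV lt pD[of u'] Q(1) by blast
            ultimately show ?thesis using uv by (simp add: mult.commute)
          qed
        qed
        then show False using Q by (simp add: card_image)
      qed
    qed
  qed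
  then show ?thesis
    by (meson not_le_imp_less)
qed

lemma max_empty_polygon_diagonal_finite:
  assumes "\<gamma> > 1"
  shows "max_empty_polygon (exp_lattice \<gamma> \<gamma>) \<noteq> \<infinity>"
proof -
  obtain k where "4 < \<gamma> ^ k"
    using real_arch_pow[OF assms] by blast
  then have k: "\<gamma> ^ k \<ge> 4" "k \<ge> 1"
    by (cases k; simp)+
  obtain N where N: "\<And>V. convex_empty (exp_lattice (\<gamma> ^ k) (\<gamma> ^ k)) V \<Longrightarrow> card V < N"
    using convex_empty_diagonal_bounded[OF k(1)] by blast
  have "max_empty_polygon (exp_lattice \<gamma> \<gamma>) \<le> enat (k * k) * max_empty_polygon (exp_lattice (\<gamma> ^ k) (\<gamma> ^ k))"
    using max_empty_polygon_power_le assms k(2) by blast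
  also have "\<dots> \<le> enat (k * k) * enat N"
    using N by (intro mult_left_mono max_empty_polygon_le) (auto intro: less_imp_le)
  finally show ?thesis by (cases "max_empty_polygon (exp_lattice \<gamma> \<gamma>)") auto
qed

subsection \<open>Concave chains and best approximations\<close>

text \<open>\<open>\<sigma> i\<close> is the slope of a supporting line at the \<open>i\<close>th
  point, strictly between the slopes of the adjacent chords. A lattice point of the hull lies above
  the ray from the origin through the last point, so by \<open>gap\<close> it lies on or above the
  ray through the \<open>i\<close>th point, where \<open>i\<close> is the strip of its column. The
  supporting line is flatter than this ray, and to the right of the \<open>i\<close>th point it runs
  below it; hence only that point remains.\<close>

lemma convex_empty_concave_chain:
  fixes m n :: "nat \<Rightarrow> nat" and \<sigma> :: "nat \<Rightarrow> real"
  assumes \<alpha>: "\<alpha> > 1" and \<beta>: "\<beta> > 1"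
    and m: "\<And>i. m i < m (Suc i)"
    and slope_less: "\<And>i. \<beta> ^ n (Suc i) - \<beta> ^ n i < \<sigma> i * (\<alpha> ^ m (Suc i) - \<alpha> ^ m i)"
    and slope_greater: "\<And>i. \<sigma> (Suc i) * (\<alpha> ^ m (Suc i) - \<alpha> ^ m i) < \<beta> ^ n (Suc i) - \<beta> ^ n i"
    and \<sigma>: "\<And>i. \<sigma> i * \<alpha> ^ m i < \<beta> ^ n i"
    and ratio: "\<And>i. \<beta> ^ n (Suc i) / \<alpha> ^ m (Suc i) < \<beta> ^ n i / \<alpha> ^ m i"
    and gap: "\<And>i k l. m i \<le> k \<Longrightarrow> k < m (Suc i) \<Longrightarrow> \<beta> ^ n N / \<alpha> ^ m N \<le> \<beta> ^ l / \<alpha> ^ k \<Longrightarrow>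
       i \<le> N \<Longrightarrow> \<beta> ^ n i / \<alpha> ^ m i \<le> \<beta> ^ l / \<alpha> ^ k"
  shows "\<exists>V. convex_empty (exp_lattice \<alpha> \<beta>) V \<and> card V = Suc N"
proof -
  define x where "x i = \<alpha> ^ m i" for i
  define y where "y i = \<beta> ^ n i" for i
  define P where "P i = (x i, y i)" for i
  have mono: "strict_mono m"
    using m by (simp add: strict_mono_Suc_iff)
  have x: "x i > 0" "x i < x (Suc i)" for i
    using \<alpha> m by (simp_all add: x_def)
  have slope: "y (Suc i) - y i < \<sigma> i * (x (Suc i) - x i)" "\<sigma> (Suc i) * (x (Suc i) - x i) < y (Suc i) - y i" for i
    using slope_less slope_greater by (simp_all add: x_def y_def)
  have dec: "\<sigma> (Suc i) < \<sigma> i" for i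
  proof -
    have "\<sigma> (Suc i) * (x (Suc i) - x i) < \<sigma> i * (x (Suc i) - x i)"
      using slope[of i] by linarith
    then show ?thesis using x(2)[of i] by simp
  qed
  have anti: "\<sigma> j \<le> \<sigma> i" if "i \<le> j" for i j
    using lift_Suc_antimono_le[of \<sigma>, OF less_imp_le[OF dec] that] .
  have xmono: "x i < x j" if "i < j" for i j
    using lift_Suc_mono_less[of x, OF x(2) that] .
  have xle: "x i \<le> x j" if "i \<le> j" for i j
    using lift_Suc_mono_le[of x, OF less_imp_le[OF x(2)] that] .
  \<comment> \<open>The conditions on neighbouring points extend to all pairs because
    \<open>\<sigma>\<close> decreases.\<close>
  have chord: "y j - y i < \<sigma> i * (x j - x i) \<and> \<sigma> j * (x j - x i) < y j - y i" if "i < j" for i j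
    using that
  proof (induction rule: less_Suc_induct)
    case (2 i j k)
    have "\<sigma> j * (x k - x j) \<le> \<sigma> i * (x k - x j)" "\<sigma> k * (x j - x i) \<le> \<sigma> j * (x j - x i)"
      using xmono[of i j] xmono[of j k] anti[of i j] anti[of j k] 2(1,2)
      by (auto intro!: mult_right_mono)
    then show ?case using 2(3,4) by (simp add: algebra_simps)
  qed (use slope in auto)
  have sep: "- \<sigma> i * x j + 1 * y j < - \<sigma> i * x i + 1 * y i" if "j \<noteq> i" for i j
    using chord[of i j] chord[of j i] that by (cases "i < j") (auto simp: algebra_simps)
  have ratio_le: "y j / x j \<le> y i / x i" if "i \<le> j" for i j
    using lift_Suc_antimono_le[of "\<lambda>i. y i / x i", OF _ that] ratio
    by (simp add: x_def y_def less_imp_le)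
  have inj: "inj_on P {..N}"
    using xmono by (auto simp: inj_on_def P_def) (metis less_irrefl linorder_neqE_nat)
  define V where "V = P ` {..N}"
  have "convex_empty (exp_lattice \<alpha> \<beta>) V"
    unfolding convex_empty_def
  proof (intro conjI ballI)
    show "finite V" by (simp add: V_def)
    show "V \<subseteq> exp_lattice \<alpha> \<beta>"
      by (auto simp: V_def P_def x_def y_def exp_lattice_def)
    show "convex hull V \<inter> exp_lattice \<alpha> \<beta> \<subseteq> V"
    proof
      fix z assume "z \<in> convex hull V \<inter> exp_lattice \<alpha> \<beta>"
      then obtain k l where hull: "z \<in> convex hull V" and z: "z = (\<alpha> ^ k, \<beta> ^ l)"
        using mem_exp_lattice_iff by blast
      have "1 * fst z + 0 * snd z \<le> x N"
        by (rule convex_hull_halfplane_le[OF hull]) (use xle in \<open>auto simp: V_def P_def\<close>)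
      then have "k \<le> m N"
        using \<alpha> by (simp add: z x_def)
      have "- 1 * fst z + 0 * snd z \<le> - x 0"
        by (rule convex_hull_halfplane_le[OF hull]) (use xle in \<open>auto simp: V_def P_def\<close>)
      then have "m 0 \<le> k"
        using \<alpha> by (simp add: z x_def)
      have "y N / x N * fst z + - 1 * snd z \<le> 0"
      proof (rule convex_hull_halfplane_le[OF hull])
        fix w assume "w \<in> V"
        then obtain i where "i \<le> N" "w = (x i, y i)" by (auto simp: V_def P_def)
        then show "y N / x N * fst w + - 1 * snd w \<le> 0"
          using ratio_le[of i N] x(1)[of i] by (simp add: pos_le_divide_eq)
      qed
      then have cone: "y N / x N \<le> \<beta> ^ l / \<alpha> ^ k"
        using \<alpha> by (simp add: z pos_le_divide_eq)
      \<comment> \<open>The predecessor of \<open>j\<close> is the index of the strip that contains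
        column \<open>k\<close>; it exists because \<open>m 0 \<le> k\<close>.\<close>
      define j where "j = (LEAST j. k < m j)"
      have "k < m (Suc k)"
        using strict_mono_imp_increasing[OF mono, of "Suc k"] by simp
      then have j: "k < m j" "\<And>i. i < j \<Longrightarrow> m i \<le> k"
        unfolding j_def by (rule LeastI, meson not_less_Least not_le_imp_less)
      obtain i where i: "j = Suc i"
        using j(1) \<open>m 0 \<le> k\<close> by (cases j) auto
      have ik: "m i \<le> k" "k < m (Suc i)"
        using j i by auto
      have "i \<le> N"
        using ik(1) \<open>k \<le> m N\<close> strict_mono_less_eq[OF mono, of i N] by linarith
      then have ge: "y i / x i \<le> \<beta> ^ l / \<alpha> ^ k"
        using gap[OF ik] cone by (simp add: x_def y_def)
      have "- \<sigma> i * fst z + 1 * snd z \<le> - \<sigma> i * x i + 1 * y i"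
      proof (rule convex_hull_halfplane_le[OF hull])
        fix w assume "w \<in> V"
        then obtain j where "w = (x j, y j)" by (auto simp: V_def P_def)
        then show "- \<sigma> i * fst w + 1 * snd w \<le> - \<sigma> i * x i + 1 * y i"
          using sep[of j i] by (cases "j = i") auto
      qed
      then have le: "\<beta> ^ l \<le> y i + \<sigma> i * (\<alpha> ^ k - x i)"
        by (simp add: z algebra_simps)
      have ge': "y i / x i * \<alpha> ^ k \<le> \<beta> ^ l"
        using ge \<alpha> by (simp add: pos_le_divide_eq)
      have "k = m i"
      proof (rule ccontr)
        assume "k \<noteq> m i"
        then have "x i < \<alpha> ^ k" using ik \<alpha> by (simp add: x_def)
        moreover have "\<sigma> i < y i / x i"
          using \<sigma>[of i] x(1)[of i] by (simp add: x_def y_def pos_less_divide_eq)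
        ultimately have "\<sigma> i * (\<alpha> ^ k - x i) < y i / x i * (\<alpha> ^ k - x i)"
          by (intro mult_strict_right_mono) auto
        also have "\<dots> = y i / x i * \<alpha> ^ k - y i"
          using x(1)[of i] by (simp add: right_diff_distrib)
        finally show False using le ge' by linarith
      qed
      then have "z = P i"
        using le ge' \<alpha> by (simp add: z P_def x_def)
      then show "z \<in> V" using \<open>i \<le> N\<close> by (simp add: V_def)
    qed
    fix v assume "v \<in> V"
    then obtain i where i: "i \<le> N" "v = P i" by (auto simp: V_def)
    show "v \<notin> convex hull (V - {v})"
    proof
      assume h: "v \<in> convex hull (V - {v})"
      have "- \<sigma> i * fst v + 1 * snd v < - \<sigma> i * x i + 1 * y i"
      proof (rule convex_hull_halfplane_less[OF h])
        fix w assume "w \<in> V - {v}"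
        then obtain j where "w = P j" "j \<noteq> i" using i by (auto simp: V_def)
        then show "- \<sigma> i * fst w + 1 * snd w < - \<sigma> i * x i + 1 * y i"
          using sep[of j i] by (simp add: P_def)
      qed
      then show False using i by (simp add: P_def)
    qed
  qed
  moreover have "card V = Suc N"
    using inj by (simp add: V_def card_image)
  ultimately show ?thesis by blast
qed

text \<open>A pair \<open>U = (m, n)\<close> of exponents stands for the point \<open>(\<alpha>\<^sup>m, \<beta>\<^sup>n)\<close>, with \<open>a = ln \<alpha>\<close> and
  \<open>b = ln \<beta>\<close>. Unimodular pairs play the role of neighbouring convergents of a continued fraction.\<close>

definition unimodular_pair :: "real \<Rightarrow> real \<Rightarrow> nat \<times> nat \<Rightarrow> nat \<times> nat \<Rightarrow> bool" where
  "unimodular_pair a b U V \<longleftrightarrow> fst U \<ge> 1 \<and> snd U \<ge> 1 \<and> fst V \<ge> 1 \<and> snd V \<ge> 1 \<and>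
     (\<forall>m n. \<exists>s t. m = s * int (fst U) + t * int (fst V) \<and> n = s * int (snd U) + t * int (snd V)) \<and>
     real (fst U) * a < real (snd U) * b \<and> real (snd V) * b < real (fst V) * a"

text \<open>For \<open>a = ln \<alpha>\<close> and \<open>b = ln \<beta>\<close> this is the
  logarithm of the slope of the ray from the origin to
  \<open>(\<alpha> ^ fst U, \<beta> ^ snd U)\<close>.\<close>

definition log_ratio :: "real \<Rightarrow> real \<Rightarrow> nat \<times> nat \<Rightarrow> real" where
  "log_ratio a b U = real (snd U) * b - real (fst U) * a"

section \<open>Unimodular pairs and one-sided best approximation\<close>

lemma unimodular_pair_log_ratio:
  assumes "unimodular_pair a b U V"
  shows "log_ratio a b U > 0" "log_ratio a b V < 0"
  using assms by (auto simp: unimodular_pair_def log_ratio_def)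

lemma unimodular_pair_coordinates:
  assumes "unimodular_pair a b U V"
  obtains s t where "m = s * int (fst U) + t * int (fst V)" "n = s * int (snd U) + t * int (snd V)"
    "real_of_int n * b - real_of_int m * a = real_of_int s * log_ratio a b U + real_of_int t * log_ratio a b V"
proof -
  obtain s t where "m = s * int (fst U) + t * int (fst V)" "n = s * int (snd U) + t * int (snd V)"
    using assms unfolding unimodular_pair_def by blast
  moreover from this have
    "real_of_int n * b - real_of_int m * a = real_of_int s * log_ratio a b U + real_of_int t * log_ratio a b V"
    by (simp add: log_ratio_def algebra_simps)
  ultimately show ?thesis using that by blast
qed

text \<open>In coordinates \<open>s\<close>, \<open>t\<close> with respect to \<open>U\<close>,
  \<open>V\<close>, a positive value with \<open>m \<ge> 0\<close> forces \<open>s \<ge> 1\<close>,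
  and a value below that of \<open>U\<close> then forces \<open>t \<ge> 1\<close>.\<close>

lemma unimodular_pair_first_positive:
  assumes pair: "unimodular_pair a b U V" and "m \<ge> 0"
    and "0 < real_of_int n * b - real_of_int m * a"
    and "real_of_int n * b - real_of_int m * a < log_ratio a b U"
  shows "int (fst U) + int (fst V) \<le> m"
proof -
  obtain s t where m: "m = s * int (fst U) + t * int (fst V)"
    and \<phi>: "real_of_int n * b - real_of_int m * a = real_of_int s * log_ratio a b U + real_of_int t * log_ratio a b V"
    using unimodular_pair_coordinates[OF pair] by metis
  note f = unimodular_pair_log_ratio[OF pair]
  have pos: "fst U \<ge> 1" "fst V \<ge> 1" using pair by (auto simp: unimodular_pair_def)
  have s: "s \<ge> 1"
  proof (rule ccontr)
    assume "\<not> s \<ge> 1"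
    then have s0: "s \<le> 0" by simp
    then have "real_of_int s * log_ratio a b U \<le> 0" using f by (simp add: mult_le_0_iff)
    then have "real_of_int t * log_ratio a b V > 0" using assms(3) \<phi> by linarith
    then have "t < 0" using f by (simp add: zero_less_mult_iff)
    then have "t * int (fst V) < 0" using pos by (simp add: mult_less_0_iff)
    moreover have "s * int (fst U) \<le> 0" using s0 by (simp add: mult_le_0_iff)
    ultimately show False using m \<open>m \<ge> 0\<close> by linarith
  qed
  have t: "t \<ge> 1"
  proof (rule ccontr)
    assume "\<not> t \<ge> 1"
    then have "real_of_int t * log_ratio a b V \<ge> 0" using f by (simp add: zero_le_mult_iff)
    moreover have "1 * log_ratio a b U \<le> real_of_int s * log_ratio a b U"
      using s f by (intro mult_right_mono) auto
    ultimately show False using assms(4) \<phi> by linarith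
  qed
  have "1 * int (fst U) \<le> s * int (fst U)" "1 * int (fst V) \<le> t * int (fst V)"
    using s t by (intro mult_right_mono; simp)+
  then show ?thesis using m by linarith
qed

text \<open>Counterpart for values below 0: negativity with \<open>m \<ge> 0\<close> forces
  \<open>t \<ge> 1\<close>, and the lower bound is just what excludes
  \<open>s \<le> -1\<close>.\<close>

lemma unimodular_pair_first_negative:
  assumes pair: "unimodular_pair a b U V" and "m \<ge> 0"
    and "real_of_int n * b - real_of_int m * a < 0"
    and "log_ratio a b V - log_ratio a b U < real_of_int n * b - real_of_int m * a"
  shows "int (fst V) \<le> m"
proof -
  obtain s t where m: "m = s * int (fst U) + t * int (fst V)"
    and \<phi>: "real_of_int n * b - real_of_int m * a = real_of_int s * log_ratio a b U + real_of_int t * log_ratio a b V"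
    using unimodular_pair_coordinates[OF pair] by metis
  note f = unimodular_pair_log_ratio[OF pair]
  have pos: "fst U \<ge> 1" "fst V \<ge> 1" using pair by (auto simp: unimodular_pair_def)
  have t: "t \<ge> 1"
  proof (rule ccontr)
    assume "\<not> t \<ge> 1"
    then have t0: "t \<le> 0" by simp
    then have "real_of_int t * log_ratio a b V \<ge> 0" using f by (simp add: zero_le_mult_iff)
    then have "real_of_int s * log_ratio a b U < 0" using assms(3) \<phi> by linarith
    then have "s < 0" using f by (simp add: mult_less_0_iff)
    then have "s * int (fst U) < 0" using pos by (simp add: mult_less_0_iff)
    moreover have "t * int (fst V) \<le> 0" using t0 by (simp add: mult_le_0_iff)
    ultimately show False using m \<open>m \<ge> 0\<close> by linarith
  qed
  have s: "s \<ge> 0"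
  proof (rule ccontr)
    assume "\<not> s \<ge> 0"
    then have "real_of_int s * log_ratio a b U \<le> - 1 * log_ratio a b U"
      using f by (intro mult_right_mono) auto
    moreover have "real_of_int t * log_ratio a b V \<le> 1 * log_ratio a b V"
      using t f by (intro mult_right_mono_neg) auto
    ultimately show False using assms(4) \<phi> by linarith
  qed
  have "0 \<le> s * int (fst U)"
    using s by simp
  moreover have "1 * int (fst V) \<le> t * int (fst V)"
    using t by (intro mult_right_mono) auto
  ultimately show ?thesis using m by linarith
qed

text \<open>Exchanging the axes reverses the sign of the log ratio, so \<open>U\<close> and
  \<open>V\<close> exchange their roles.\<close>

lemma unimodular_pair_swap:
  assumes "unimodular_pair a b U V"
  shows "unimodular_pair b a (prod.swap V) (prod.swap U)"
proof -
  have "\<exists>s t. m = s * int (snd V) + t * int (snd U) \<and> n = s * int (fst V) + t * int (fst U)" for m n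
  proof -
    obtain s t where "n = s * int (fst U) + t * int (fst V)" "m = s * int (snd U) + t * int (snd V)"
      using assms unfolding unimodular_pair_def by blast
    then show ?thesis by (intro exI[of _ t] exI[of _ s]) simp
  qed
  then show ?thesis using assms by (simp add: unimodular_pair_def)
qed

lemma ratio_eq_exp:
  assumes "\<alpha> > 1" "\<beta> > 1"
  shows "\<beta> ^ n / \<alpha> ^ m = exp (log_ratio (ln \<alpha>) (ln \<beta>) (m, n))"
  using assms by (simp add: log_ratio_def exp_diff exp_of_nat_mult)

text \<open>The points belong to the exponent pairs \<open>i * V\<close> with
  \<open>i \<le> N\<close>; by \<open>B < A\<close> they form a concave chain. \<open>run\<close>
  says that the log ratio falls along the progression by at most that of \<open>U\<close>, which is
  the range that \<open>unimodular_pair_first_negative\<close> covers.\<close>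

lemma convex_empty_arithmetic_progression:
  assumes \<alpha>: "\<alpha> > 1" and \<beta>: "\<beta> > 1" and pair: "unimodular_pair (ln \<alpha>) (ln \<beta>) U V"
    and run: "real N * - log_ratio (ln \<alpha>) (ln \<beta>) V \<le> log_ratio (ln \<alpha>) (ln \<beta>) U"
  shows "\<exists>W. convex_empty (exp_lattice \<alpha> \<beta>) W \<and> card W = Suc N"
proof -
  let ?a = "ln \<alpha>" and ?b = "ln \<beta>"
  define A where "A = \<alpha> ^ fst V"
  define B where "B = \<beta> ^ snd V"
  have V1: "fst V \<ge> 1" "snd V \<ge> 1" using pair by (auto simp: unimodular_pair_def)
  note f = unimodular_pair_log_ratio[OF pair]
  have "B / A < 1"
    using ratio_eq_exp[OF \<alpha> \<beta>, of "snd V" "fst V"] f by (simp add: A_def B_def)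
  then have BA: "B < A" using \<alpha> by (simp add: A_def)
  have B1: "B > 1" using V1 \<beta> by (simp add: B_def one_less_power)
  \<comment> \<open>Chosen so that \<open>\<kappa> * (A - 1)\<close> is the mean of
    \<open>B - 1\<close> and \<open>A * (B - 1) / B\<close>, the two bounds that the adjacent chords
    impose.\<close>
  define \<kappa> where "\<kappa> = (B - 1) * (A + B) / (2 * B * (A - 1))"
  have \<kappa>1: "\<kappa> < 1"
  proof -
    have "(A - B) * (B + 1) > 0" using BA B1 by simp
    then have "(B - 1) * (A + B) < 2 * B * (A - 1)" by (simp add: algebra_simps)
    then show ?thesis using BA B1 by (simp add: \<kappa>_def pos_divide_less_eq)
  qed
  have \<kappa>A: "\<kappa> * (A - 1) = (B - 1) * (A + B) / (2 * B)"
    using BA B1 by (simp add: \<kappa>_def)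
  have \<kappa>_gt: "B - 1 < \<kappa> * (A - 1)"
    unfolding \<kappa>A using BA B1 by (simp add: pos_less_divide_eq)
  have \<kappa>_lt: "B * (\<kappa> * (A - 1)) < A * (B - 1)"
  proof -
    have "B * (\<kappa> * (A - 1)) = (B - 1) * ((A + B) / 2)"
      unfolding \<kappa>A using B1 by simp
    also have "\<dots> < (B - 1) * A"
      using BA B1 by (intro mult_strict_left_mono) auto
    finally show ?thesis by (simp add: mult.commute)
  qed
  define \<sigma> where "\<sigma> i = (B / A) ^ i * \<kappa>" for i
  have pw: "\<alpha> ^ (i * fst V) = A ^ i" "\<beta> ^ (i * snd V) = B ^ i" for i
    by (simp_all add: A_def B_def mult.commute flip: power_mult)
  have \<sigma>A: "\<sigma> i * A ^ i = B ^ i * \<kappa>" for i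
    using BA B1 by (simp add: \<sigma>_def power_divide)
  show ?thesis
  proof (rule convex_empty_concave_chain[OF \<alpha> \<beta>, where m = "\<lambda>i. i * fst V" and n = "\<lambda>i. i * snd V" and \<sigma> = \<sigma>])
    show "i * fst V < Suc i * fst V" for i using V1 by simp
    show "\<beta> ^ (Suc i * snd V) - \<beta> ^ (i * snd V) < \<sigma> i * (\<alpha> ^ (Suc i * fst V) - \<alpha> ^ (i * fst V))" for i
    proof -
      have "B ^ i * (B - 1) < B ^ i * (\<kappa> * (A - 1))"
        using \<kappa>_gt B1 by simp
      also have "\<dots> = (\<sigma> i * A ^ i) * (A - 1)" by (simp add: \<sigma>A)
      finally show ?thesis unfolding pw by (simp add: algebra_simps)
    qed
    show "\<sigma> (Suc i) * (\<alpha> ^ (Suc i * fst V) - \<alpha> ^ (i * fst V)) < \<beta> ^ (Suc i * snd V) - \<beta> ^ (i * snd V)" for i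
    proof -
      have "\<sigma> (Suc i) = B / A * \<sigma> i" "A ^ Suc i - A ^ i = A ^ i * (A - 1)"
        by (simp_all add: \<sigma>_def algebra_simps)
      then have "\<sigma> (Suc i) * (A ^ Suc i - A ^ i) = B / A * ((\<sigma> i * A ^ i) * (A - 1))"
        by (simp only: mult.assoc)
      also have "\<dots> = B ^ i * (B * (\<kappa> * (A - 1)) / A)" by (simp add: \<sigma>A)
      also have "\<dots> < B ^ i * (B - 1)"
        using \<kappa>_lt BA B1 by (simp add: pos_divide_less_eq mult.commute)
      finally show ?thesis unfolding pw by (simp add: algebra_simps)
    qed
    show "\<sigma> i * \<alpha> ^ (i * fst V) < \<beta> ^ (i * snd V)" for i
      using \<kappa>1 B1 unfolding pw \<sigma>A by simp
    show "\<beta> ^ (Suc i * snd V) / \<alpha> ^ (Suc i * fst V) < \<beta> ^ (i * snd V) / \<alpha> ^ (i * fst V)" for i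
      unfolding pw using BA B1 by (simp add: field_simps)
    fix i k l
    assume k: "i * fst V \<le> k" "k < Suc i * fst V" and iN: "i \<le> N"
      and lower: "\<beta> ^ (N * snd V) / \<alpha> ^ (N * fst V) \<le> \<beta> ^ l / \<alpha> ^ k"
    show "\<beta> ^ (i * snd V) / \<alpha> ^ (i * fst V) \<le> \<beta> ^ l / \<alpha> ^ k"
    proof (rule ccontr)
      assume "\<not> \<beta> ^ (i * snd V) / \<alpha> ^ (i * fst V) \<le> \<beta> ^ l / \<alpha> ^ k"
      then have upper: "log_ratio ?a ?b (k, l) < real i * log_ratio ?a ?b V"
        unfolding ratio_eq_exp[OF \<alpha> \<beta>] by (simp add: log_ratio_def algebra_simps)
      have lower': "real N * log_ratio ?a ?b V \<le> log_ratio ?a ?b (k, l)"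
        using lower unfolding ratio_eq_exp[OF \<alpha> \<beta>] by (simp add: log_ratio_def algebra_simps)
      \<comment> \<open>Subtracting \<open>i * V\<close> moves the offending point to a column
        before \<open>fst V\<close>, with a negative log ratio too small in size for that.\<close>
      define k' where "k' = int k - int i * int (fst V)"
      define l' where "l' = int l - int i * int (snd V)"
      have \<phi>: "real_of_int l' * ?b - real_of_int k' * ?a = log_ratio ?a ?b (k, l) - real i * log_ratio ?a ?b V"
        by (simp add: k'_def l'_def log_ratio_def algebra_simps)
      have k': "k' \<ge> 0" "k' < int (fst V)"
        using k by (simp_all add: k'_def algebra_simps flip: of_nat_mult of_nat_add)
      have "real i * log_ratio ?a ?b V \<le> 0" using f by (simp add: mult_nonneg_nonpos)
      then have "int (fst V) \<le> k'"
        using upper lower' run f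
        by (intro unimodular_pair_first_negative[OF pair k'(1), of l']) (simp_all add: \<phi>)
      then show False using k' by simp
    qed
  qed
qed


section \<open>Construction and refinement of unimodular pairs\<close>

lemma unimodular_pairI:
  assumes "fst U \<ge> 1" "snd U \<ge> 1" "fst V \<ge> 1" "snd V \<ge> 1"
    and "\<And>m n. \<exists>s t. m = s * int (fst U) + t * int (fst V) \<and> n = s * int (snd U) + t * int (snd V)"
    and "log_ratio a b U > 0" "log_ratio a b V < 0"
  shows "unimodular_pair a b U V"
  using assms by (auto simp: unimodular_pair_def log_ratio_def)

lemma unimodular_pair_span:
  assumes "unimodular_pair a b U V"
  shows "\<exists>s t. m = s * int (fst U) + t * int (fst V) \<and> n = s * int (snd U) + t * int (snd V)"
  using assms by (simp add: unimodular_pair_def)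

lemma obtain_floor_multiple:
  fixes x y :: real
  assumes "y > 0" "x \<ge> 0" "\<And>t::nat. x \<noteq> real t * y"
  obtains t :: nat where "real t * y < x" "x < real t * y + y"
proof
  define t where "t = nat \<lfloor>x / y\<rfloor>"
  have "real t \<le> x / y" "x / y < real t + 1"
    using assms by (auto simp: t_def)
  then have "real t * y \<le> x" "x < real t * y + y"
    using assms(1) by (simp_all add: field_simps)
  then show "real t * y < x" "x < real t * y + y"
    using assms(3)[of t] by auto
qed

text \<open>A continued fraction step: \<open>V' = V + t * U\<close> with the largest
  \<open>t\<close> that keeps the log ratio negative, so that \<open>U + V'\<close> has a positive
  one. Both changes of basis are unimodular.\<close>

lemma unimodular_pair_step:
  assumes pair: "unimodular_pair a b U V"
    and irr: "\<And>m n :: nat. m \<ge> 1 \<Longrightarrow> real n * b \<noteq> real m * a"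
  shows "\<exists>V'. unimodular_pair a b U V' \<and> unimodular_pair a b (fst U + fst V', snd U + snd V') V'
    \<and> - log_ratio a b V' < log_ratio a b U"
proof -
  note f = unimodular_pair_log_ratio[OF pair]
  have pos: "fst U \<ge> 1" "snd U \<ge> 1" "fst V \<ge> 1" "snd V \<ge> 1"
    using pair by (auto simp: unimodular_pair_def)
  have "- log_ratio a b V \<noteq> real t * log_ratio a b U" for t :: nat
  proof
    assume "- log_ratio a b V = real t * log_ratio a b U"
    then have "real (snd V + t * snd U) * b = real (fst V + t * fst U) * a"
      by (simp add: log_ratio_def algebra_simps)
    moreover have "fst V + t * fst U \<ge> 1" using pos by simp
    ultimately show False using irr by blast
  qed
  then obtain t :: nat where t: "real t * log_ratio a b U < - log_ratio a b V"
      "- log_ratio a b V < real t * log_ratio a b U + log_ratio a b U"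
    using obtain_floor_multiple[of "log_ratio a b U" "- log_ratio a b V"] f by auto
  define V' where "V' = (fst V + t * fst U, snd V + t * snd U)"
  have log_ratio': "log_ratio a b V' = log_ratio a b V + real t * log_ratio a b U"
    by (simp add: V'_def log_ratio_def algebra_simps)
  have span: "\<exists>u v. m = u * int (fst U) + v * int (fst V') \<and> n = u * int (snd U) + v * int (snd V')" for m n
  proof -
    obtain u v where "m = u * int (fst U) + v * int (fst V)" "n = u * int (snd U) + v * int (snd V)"
      using unimodular_pair_span[OF pair] by blast
    then show ?thesis
      by (intro exI[of _ "u - v * int t"] exI[of _ v]) (simp add: V'_def algebra_simps)
  qed
  have 1: "unimodular_pair a b U V'"
    using pos f t log_ratio' by (intro unimodular_pairI span) (auto simp: V'_def)
  have "unimodular_pair a b (fst U + fst V', snd U + snd V') V'"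
  proof (rule unimodular_pairI)
    fix m n
    obtain u v where "m = u * int (fst U) + v * int (fst V')" "n = u * int (snd U) + v * int (snd V')"
      using span by blast
    then show "\<exists>s w. m = s * int (fst (fst U + fst V', snd U + snd V')) + w * int (fst V') \<and>
        n = s * int (snd (fst U + fst V', snd U + snd V')) + w * int (snd V')"
      by (intro exI[of _ u] exI[of _ "v - u"]) (simp add: algebra_simps)
    have "log_ratio a b (fst U + fst V', snd U + snd V') = log_ratio a b U + log_ratio a b V'"
      by (simp add: log_ratio_def algebra_simps)
    then show "log_ratio a b (fst U + fst V', snd U + snd V') > 0"
      using t log_ratio' by linarith
  qed (use pos t log_ratio' in \<open>auto simp: V'_def\<close>)
  moreover have "- log_ratio a b V' < log_ratio a b U" using t log_ratio' by linarith
  ultimately show ?thesis using 1 by blast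
qed

text \<open>Two steps of the Euclidean algorithm for \<open>b\<close> and \<open>a\<close>:
  \<open>\<theta>\<close> is the log ratio of \<open>(p, 1)\<close>, and \<open>V\<close> is
  \<open>(1, 0)\<close> plus \<open>q\<close> times \<open>(p, 1)\<close>. Adding
  \<open>(p, 1)\<close> once more gives \<open>U\<close>. All entries are positive even for
  \<open>p = 0\<close>.\<close>

lemma unimodular_pair_exists:
  assumes a: "a > 0" and b: "b > 0"
    and irr: "\<And>m n :: nat. m \<ge> 1 \<Longrightarrow> real n * b \<noteq> real m * a"
  shows "\<exists>U V. unimodular_pair a b U V"
proof -
  have "b \<noteq> real t * a" for t :: nat
    using irr[of t 1] b by (cases t) auto
  then obtain p :: nat where p: "real p * a < b" "b < real p * a + a"
    using obtain_floor_multiple[of a b] a b by auto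
  define \<theta> where "\<theta> = b - real p * a"
  have "a \<noteq> real t * \<theta>" for t :: nat
  proof
    assume "a = real t * \<theta>"
    then have "real t * b = real (1 + t * p) * a" by (simp add: \<theta>_def algebra_simps)
    then show False using irr[of "1 + t * p" t] by simp
  qed
  then obtain q :: nat where q: "real q * \<theta> < a" "a < real q * \<theta> + \<theta>"
    using obtain_floor_multiple[of \<theta> a] a p by (auto simp: \<theta>_def)
  have q1: "q \<ge> 1" using q p by (cases q) (auto simp: \<theta>_def)
  define V where "V = (1 + p * q, q)"
  define U where "U = (p + 1 + p * q, 1 + q)"
  have "unimodular_pair a b U V"
  proof (rule unimodular_pairI)
    fix m n :: int
    \<comment> \<open>\<open>t\<close> and \<open>n\<close> are the coordinates with respect to
      \<open>(1, 0) = V - q * (U - V)\<close> and \<open>(p, 1) = U - V\<close>.\<close>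
    define t where "t = m - n * int p"
    show "\<exists>s t. m = s * int (fst U) + t * int (fst V) \<and> n = s * int (snd U) + t * int (snd V)"
      by (intro exI[of _ "n - int q * t"] exI[of _ "t - (n - int q * t)"])
        (simp add: U_def V_def t_def algebra_simps)
    show "log_ratio a b U > 0" "log_ratio a b V < 0"
      using q by (simp_all add: log_ratio_def U_def V_def \<theta>_def algebra_simps)
  qed (use q1 in \<open>auto simp: U_def V_def\<close>)
  then show ?thesis by blast
qed

lemma finite_positive_lower_bound:
  fixes E :: "real set"
  assumes "finite E"
  shows "\<exists>\<epsilon>>0. \<forall>e\<in>E. e > 0 \<longrightarrow> \<epsilon> \<le> e"
  using assms
proof (induction rule: finite_induct)
  case (insert x F)
  then obtain \<epsilon> where "\<epsilon> > 0" "\<forall>e\<in>F. e > 0 \<longrightarrow> \<epsilon> \<le> e" by blast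
  then show ?case
    by (intro exI[of _ "if x > 0 then min \<epsilon> x else \<epsilon>"]) auto
qed (auto intro: exI[of _ 1])

text \<open>If the first exponent is at most \<open>M\<close> and the log ratio is negative, the
  second exponent is bounded as well. Finitely many pairs remain, and their log ratios stay away
  from 0.\<close>

lemma small_negative_log_ratio_fst_large:
  assumes "b > 0"
  shows "\<exists>\<epsilon>>0. \<forall>V. log_ratio a b V < 0 \<longrightarrow> - log_ratio a b V < \<epsilon> \<longrightarrow> M < fst V"
proof -
  define K where "K = nat \<lceil>real M * \<bar>a\<bar> / b\<rceil>"
  define E where "E = (\<lambda>V. - log_ratio a b V) ` ({..M} \<times> {..K})"
  have "finite E" by (simp add: E_def)
  then obtain \<epsilon> where \<epsilon>: "\<epsilon> > 0" "\<forall>e\<in>E. e > 0 \<longrightarrow> \<epsilon> \<le> e"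
    using finite_positive_lower_bound by blast
  have "M < fst V" if V: "log_ratio a b V < 0" "- log_ratio a b V < \<epsilon>" for V
  proof (rule ccontr)
    assume "\<not> M < fst V"
    then have M: "fst V \<le> M" by simp
    have "real (snd V) * b \<le> real (fst V) * a" using V by (simp add: log_ratio_def)
    also have "\<dots> \<le> real (fst V) * \<bar>a\<bar>" by (intro mult_left_mono) auto
    also have "\<dots> \<le> real M * \<bar>a\<bar>" using M by (intro mult_right_mono) auto
    finally have "real (snd V) \<le> real M * \<bar>a\<bar> / b" using assms by (simp add: pos_le_divide_eq)
    then have "snd V \<le> K" unfolding K_def by linarith
    then have "V \<in> {..M} \<times> {..K}" using M by (simp add: mem_Times_iff)
    then have "- log_ratio a b V \<in> E" unfolding E_def by (rule imageI)
    then have "\<epsilon> \<le> - log_ratio a b V" using V \<epsilon>(2) by simp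
    then show False using V by simp
  qed
  then show ?thesis using \<epsilon>(1) by blast
qed

text \<open>Converts differences of log ratios into differences of slopes. The factor 6 comes from
  \<open>exp x \<le> 3\<close> and \<open>exp y - 1 \<le> 2 * y\<close>.\<close>

lemma exp_diff_bounds:
  fixes x y :: real
  assumes "x \<ge> 0" "y \<ge> 0" "x + y \<le> 1"
  shows "exp (x + y) - exp x \<le> 6 * y" "y \<le> exp (x + y) - exp x"
proof -
  have eq: "exp (x + y) - exp x = exp x * (exp y - 1)"
    by (simp add: exp_add algebra_simps)
  have "exp x \<le> exp 1" using assms by simp
  then have ex: "exp x \<le> 3" using exp_le by linarith
  have "exp y \<le> 1 + y + y\<^sup>2" using assms by (intro exp_bound) auto
  moreover have "y\<^sup>2 \<le> y" using assms by (simp add: power2_eq_square mult_left_le)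
  ultimately have ey: "exp y - 1 \<le> 2 * y" by linarith
  have "exp x * (exp y - 1) \<le> 3 * (2 * y)"
    using ex ey assms by (intro mult_mono) auto
  then show "exp (x + y) - exp x \<le> 6 * y" unfolding eq by simp
  have "y \<le> exp y - 1"
    using exp_ge_add_one_self[of y] by linarith
  then have "1 * y \<le> exp x * (exp y - 1)"
    using assms by (intro mult_mono) auto
  then show "y \<le> exp (x + y) - exp x" unfolding eq by simp
qed

text \<open>The hypothesis with \<open>C\<close> expresses that the partial quotients are bounded. The slope of the
  separating line at the \<open>i\<close>-th point is the ratio of the coordinates of the next point.\<close>

lemma convex_empty_best_approximations:
  assumes \<alpha>: "\<alpha> > 1" and \<beta>: "\<beta> > 1"
    and U: "\<And>i. U (Suc i) = (fst (U i) + fst (V (Suc i)), snd (U i) + snd (V (Suc i)))"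
    and pair: "\<And>i. unimodular_pair (ln \<alpha>) (ln \<beta>) (U i) (V (Suc i))"
    and gap: "\<And>i. - log_ratio (ln \<alpha>) (ln \<beta>) (V (Suc i)) \<le> C * - log_ratio (ln \<alpha>) (ln \<beta>) (V (Suc (Suc i)))"
    and small: "log_ratio (ln \<alpha>) (ln \<beta>) (U 0) \<le> 1" and C: "C \<ge> 0"
    and large: "\<And>i. 1 + 6 * C < \<alpha> ^ fst (V i)"
  shows "\<exists>W. convex_empty (exp_lattice \<alpha> \<beta>) W \<and> card W = Suc N"
proof -
  let ?f = "log_ratio (ln \<alpha>) (ln \<beta>)"
  define x where "x i = \<alpha> ^ fst (U i)" for i
  define r where "r i = exp (?f (U i))" for i
  have y: "\<beta> ^ snd (U i) = r i * x i" for i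
    using ratio_eq_exp[OF \<alpha> \<beta>, of "snd (U i)" "fst (U i)"] \<alpha> by (simp add: r_def x_def field_simps)
  have fU: "?f (U i) > 0" and fV: "?f (V (Suc i)) < 0" for i
    using unimodular_pair_log_ratio[OF pair] by blast+
  have fSuc: "?f (U i) = ?f (U (Suc i)) + - ?f (V (Suc i))" for i
    by (simp add: U log_ratio_def algebra_simps)
  have "?f (U (Suc i)) \<le> ?f (U i)" for i
    using fSuc[of i] fV[of i] by linarith
  then have "?f (U i) \<le> ?f (U 0)" for i
    using lift_Suc_antimono_le[of "\<lambda>i. ?f (U i)" 0 i] by simp
  then have le1: "?f (U i) \<le> 1" for i
    using small order_trans by blast
  have x0: "x i > 0" for i using \<alpha> by (simp add: x_def)
  have xSuc: "x (Suc i) = \<alpha> ^ fst (V (Suc i)) * x i" for i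
    by (simp add: x_def U power_add)
  have rdec: "r (Suc i) < r i" for i
    using fSuc[of i] fV[of i] by (simp add: r_def)
  \<comment> \<open>Consecutive drops of \<open>r\<close> are comparable: \<open>C\<close> bounds
    the ratio of the drops of the logarithms, and 6 is the loss from \<open>exp\<close>.\<close>
  have r_gap: "r i - r (Suc i) \<le> 6 * C * (r (Suc i) - r (Suc (Suc i)))" for i
  proof -
    have "r i - r (Suc i) \<le> 6 * - ?f (V (Suc i))"
      using exp_diff_bounds(1)[of "?f (U (Suc i))" "- ?f (V (Suc i))"] fU[of "Suc i"] fV[of i] le1[of i]
      unfolding r_def fSuc[of i] by simp
    also have "\<dots> \<le> 6 * (C * - ?f (V (Suc (Suc i))))"
      using gap[of i] by linarith
    also have "\<dots> \<le> 6 * (C * (r (Suc i) - r (Suc (Suc i))))"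
      using exp_diff_bounds(2)[of "?f (U (Suc (Suc i)))" "- ?f (V (Suc (Suc i)))"]
        fU[of "Suc (Suc i)"] fV[of "Suc i"] le1[of "Suc i"] C
      unfolding r_def fSuc[of "Suc i"] by (intro mult_left_mono) auto
    finally show ?thesis by simp
  qed
  have Vpos: "fst (V (Suc i)) \<ge> 1" for i
    using pair[of i] by (simp add: unimodular_pair_def)
  show ?thesis
  proof (rule convex_empty_concave_chain[OF \<alpha> \<beta>, where m = "\<lambda>i. fst (U i)" and n = "\<lambda>i. snd (U i)"
        and \<sigma> = "\<lambda>i. r (Suc i)"], unfold y x_def[symmetric])
    show "fst (U i) < fst (U (Suc i))" for i using Vpos[of i] by (simp add: U)
    show "r (Suc i) * x (Suc i) - r i * x i < r (Suc i) * (x (Suc i) - x i)" for i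
      using rdec[of i] x0[of i] by (simp add: algebra_simps)
    \<comment> \<open>The drop of \<open>r\<close> over two steps is at most
      \<open>1 + 6 * C\<close> times the later one, while \<open>x (Suc i)\<close> exceeds
      \<open>x i\<close> by a larger factor.\<close>
    show "r (Suc (Suc i)) * (x (Suc i) - x i) < r (Suc i) * x (Suc i) - r i * x i" for i
    proof -
      have "(r i - r (Suc (Suc i))) * x i \<le> ((1 + 6 * C) * (r (Suc i) - r (Suc (Suc i)))) * x i"
        using r_gap[of i] x0[of i] by (intro mult_right_mono) (auto simp: algebra_simps)
      also have "\<dots> = (1 + 6 * C) * ((r (Suc i) - r (Suc (Suc i))) * x i)" by simp
      also have "\<dots> < \<alpha> ^ fst (V (Suc i)) * ((r (Suc i) - r (Suc (Suc i))) * x i)"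
        using large[of "Suc i"] x0[of i] rdec[of "Suc i"] by (intro mult_strict_right_mono) auto
      also have "\<dots> = (r (Suc i) - r (Suc (Suc i))) * x (Suc i)" by (simp add: xSuc)
      finally show ?thesis by (simp add: algebra_simps)
    qed
    show "r (Suc i) * x i < r i * x i" for i using rdec x0 by simp
    show "r (Suc i) * x (Suc i) / x (Suc i) < r i * x i / x i" for i
      using rdec[of i] x0[of i] x0[of "Suc i"] by simp
    fix i k l
    assume k: "fst (U i) \<le> k" "k < fst (U (Suc i))"
      and lower: "r N * x N / x N \<le> \<beta> ^ l / \<alpha> ^ k"
    show "r i * x i / x i \<le> \<beta> ^ l / \<alpha> ^ k"
    proof (rule ccontr)
      assume "\<not> r i * x i / x i \<le> \<beta> ^ l / \<alpha> ^ k"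
      then have upper: "?f (k, l) < ?f (U i)"
        using x0[of i] unfolding ratio_eq_exp[OF \<alpha> \<beta>] by (simp add: r_def)
      have "?f (U N) \<le> ?f (k, l)"
        using lower x0[of N] unfolding ratio_eq_exp[OF \<alpha> \<beta>] by (simp add: r_def)
      then have "?f (k, l) > 0" using fU[of N] by linarith
      then have "int (fst (U i)) + int (fst (V (Suc i))) \<le> int k"
        using upper by (intro unimodular_pair_first_positive[OF pair, of _ "int l"]) (simp_all add: log_ratio_def)
      then show False using k by (simp add: U)
    qed
  qed
qed

text \<open>If there is no such set, the log ratios in every unimodular pair are comparable up to
  the factor \<open>N\<close>. Under iterated refinement they then decay geometrically, and a tail
  of the sequence satisfies the hypotheses of
  \<open>convex_empty_best_approximations\<close>.\<close>

lemma convex_empty_irrational_exists: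
  assumes \<alpha>: "\<alpha> > 1" and \<beta>: "\<beta> > 1"
    and irr: "\<And>m n :: nat. m \<ge> 1 \<Longrightarrow> real n * ln \<beta> \<noteq> real m * ln \<alpha>"
  shows "\<exists>W. convex_empty (exp_lattice \<alpha> \<beta>) W \<and> card W = Suc N"
proof (rule ccontr)
  assume none: "\<not> ?thesis"
  let ?f = "log_ratio (ln \<alpha>) (ln \<beta>)"
  let ?pair = "unimodular_pair (ln \<alpha>) (ln \<beta>)"
  \<comment> \<open>Either bound, if violated, allows an arithmetic progression of
    \<open>N + 1\<close> points; the second case uses the lattice with exchanged axes.\<close>
  have bound: "?f U < real N * - ?f V" "- ?f V < real N * ?f U" if UV: "?pair U V" for U V
  proof -
    show "?f U < real N * - ?f V"
      using convex_empty_arithmetic_progression[OF \<alpha> \<beta> UV, of N] none by fastforce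
    have sw: "log_ratio (ln \<beta>) (ln \<alpha>) (prod.swap W) = - ?f W" for W
      by (simp add: log_ratio_def)
    show "- ?f V < real N * ?f U"
    proof (rule ccontr)
      assume "\<not> - ?f V < real N * ?f U"
      then have "real N * - log_ratio (ln \<beta>) (ln \<alpha>) (prod.swap U) \<le> log_ratio (ln \<beta>) (ln \<alpha>) (prod.swap V)"
        unfolding sw by simp
      then obtain W where "convex_empty (exp_lattice \<beta> \<alpha>) W" "card W = Suc N"
        using convex_empty_arithmetic_progression[OF \<beta> \<alpha> unimodular_pair_swap[OF UV]] by blast
      then show False
        using none convex_empty_swap[of \<beta> \<alpha> W] by (metis card_image inj_swap)
    qed
  qed
  have ab: "ln \<alpha> > 0" "ln \<beta> > 0" using \<alpha> \<beta> by simp_all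
  define Q where "Q = (\<lambda>(U, V :: nat \<times> nat) (U', V'). ?pair U V' \<and> - ?f V' < ?f U \<and>
      U' = (fst U + fst V', snd U + snd V'))"
  have "\<exists>F. \<forall>i. (\<lambda>i (U, V). ?pair U V) i (F i) \<and> (\<lambda>i. Q) i (F i) (F (Suc i))"
  proof (rule dependent_nat_choice)
    show "\<exists>UV. case UV of (U, V) \<Rightarrow> ?pair U V"
      using unimodular_pair_exists[OF ab irr] by auto
    fix UV :: "(nat \<times> nat) \<times> nat \<times> nat" and i :: nat
    assume "case UV of (U, V) \<Rightarrow> ?pair U V"
    then show "\<exists>UV'. (case UV' of (U, V) \<Rightarrow> ?pair U V) \<and> Q UV UV'"
      using unimodular_pair_step[OF _ irr] by (cases UV) (force simp: Q_def)
  qed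
  then obtain F where F: "\<And>i. ?pair (fst (F i)) (snd (F i))" "\<And>i. Q (F i) (F (Suc i))"
    by (auto simp: case_prod_unfold)
  define U where "U i = fst (F i)" for i
  define V where "V i = snd (F i)" for i
  have pair: "?pair (U i) (V i)" and pair': "?pair (U i) (V (Suc i))"
    and less: "- ?f (V (Suc i)) < ?f (U i)"
    and USuc: "U (Suc i) = (fst (U i) + fst (V (Suc i)), snd (U i) + snd (V (Suc i)))" for i
    using F[of i] by (auto simp: U_def V_def Q_def case_prod_unfold)
  have fU: "?f (U i) > 0" and fV: "?f (V i) < 0" for i
    using unimodular_pair_log_ratio[OF pair] by blast+
  have N0: "real N > 0"
    using bound(1)[OF pair[of 0]] fU[of 0] fV[of 0] by (cases N) auto
  \<comment> \<open>By the first bound a refinement step lowers the log ratio of \<open>U\<close> by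
    at least its \<open>N\<close>th part.\<close>
  define c where "c = 1 - 1 / real N"
  have c: "0 \<le> c" "c < 1" using N0 by (auto simp: c_def)
  have fSuc: "?f (U (Suc i)) = ?f (U i) + ?f (V (Suc i))" for i
    by (simp add: USuc log_ratio_def algebra_simps)
  have shrink: "?f (U (Suc i)) \<le> c * ?f (U i)" for i
  proof -
    have "?f (U i) / real N \<le> - ?f (V (Suc i))"
      using bound(1)[OF pair'[of i]] N0 by (simp add: field_simps)
    then show ?thesis unfolding fSuc c_def by (simp add: algebra_simps)
  qed
  have geo: "?f (U i) \<le> ?f (U 0) * c ^ i" for i
  proof (induction i)
    case (Suc i)
    have "c * ?f (U i) \<le> c * (?f (U 0) * c ^ i)" using Suc c by (intro mult_left_mono)
    then show ?case using shrink[of i] by (simp add: mult_ac)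
  qed simp
  \<comment> \<open>Successive negative log ratios are compared through the positive one between
    them, at a factor \<open>N\<close> each time.\<close>
  define C where "C = real N * real N"
  obtain M where M: "1 + 6 * C < \<alpha> ^ M"
    using real_arch_pow[OF \<alpha>] by blast
  obtain \<epsilon> where \<epsilon>: "\<epsilon> > 0" "\<And>V. ?f V < 0 \<Longrightarrow> - ?f V < \<epsilon> \<Longrightarrow> M < fst V"
    using small_negative_log_ratio_fst_large[OF ab(2)] by metis
  have "(\<lambda>i. ?f (U 0) * c ^ i) \<longlonglongrightarrow> ?f (U 0) * 0"
    using c by (intro tendsto_mult_left LIMSEQ_power_zero) auto
  moreover have "min 1 (\<epsilon> / real N) > 0" using \<epsilon> N0 by simp
  ultimately have "eventually (\<lambda>i. ?f (U 0) * c ^ i < min 1 (\<epsilon> / real N)) sequentially"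
    by (intro order_tendstoD) auto
  \<comment> \<open>Past \<open>I\<close> the log ratio of \<open>U\<close> is below 1, and that of
    \<open>V\<close>, at most \<open>N\<close> times as large in size, is below
    \<open>\<epsilon>\<close>; hence \<open>fst (V i)\<close> exceeds \<open>M\<close>.\<close>
  then obtain I where I: "\<And>i. i \<ge> I \<Longrightarrow> ?f (U 0) * c ^ i < min 1 (\<epsilon> / real N)"
    unfolding eventually_sequentially by blast
  have I': "?f (U i) < 1" "?f (U i) < \<epsilon> / real N" if "i \<ge> I" for i
    using I[OF that] geo[of i] by auto
  have VM: "M < fst (V i)" if "i \<ge> I" for i
  proof (rule \<epsilon>(2)[OF fV])
    have "- ?f (V i) < real N * ?f (U i)" using bound(2)[OF pair] .
    also have "\<dots> \<le> \<epsilon>" using I'(2)[OF that] N0 by (simp add: field_simps)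
    finally show "- ?f (V i) < \<epsilon>" .
  qed
  have "\<exists>W. convex_empty (exp_lattice \<alpha> \<beta>) W \<and> card W = Suc N"
  proof (rule convex_empty_best_approximations[OF \<alpha> \<beta>, where U = "\<lambda>i. U (I + i)" and V = "\<lambda>i. V (I + i)" and C = C])
    show "U (I + Suc i) = (fst (U (I + i)) + fst (V (I + Suc i)), snd (U (I + i)) + snd (V (I + Suc i)))" for i
      using USuc[of "I + i"] by simp
    show "?pair (U (I + i)) (V (I + Suc i))" for i using pair'[of "I + i"] by simp
    show "- ?f (V (I + Suc i)) \<le> C * - ?f (V (I + Suc (Suc i)))" for i
    proof -
      have "- ?f (V (I + Suc i)) \<le> real N * ?f (U (I + Suc i))"
        using bound(2)[OF pair[of "I + Suc i"]] by simp
      also have "\<dots> \<le> real N * (real N * - ?f (V (Suc (I + Suc i))))"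
        using bound(1)[OF pair'[of "I + Suc i"]] by (intro mult_left_mono) auto
      finally show ?thesis by (simp add: C_def)
    qed
    show "?f (U (I + 0)) \<le> 1" using I'(1)[of I] by simp
    show "C \<ge> 0" by (simp add: C_def)
    show "1 + 6 * C < \<alpha> ^ fst (V (I + i))" for i
    proof -
      have "\<alpha> ^ M \<le> \<alpha> ^ fst (V (I + i))"
        using VM[of "I + i"] \<alpha> by (intro power_increasing) auto
      then show ?thesis using M by linarith
    qed
  qed
  then show False using none by blast
qed

subsection \<open>Rational and irrational ratio of logarithms\<close>

lemma max_empty_polygon_irrational:
  assumes \<alpha>: "\<alpha> > 1" and \<beta>: "\<beta> > 1" and irr: "log \<alpha> \<beta> \<notin> \<rat>"
  shows "max_empty_polygon (exp_lattice \<alpha> \<beta>) = \<infinity>"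
proof -
  have indep: "real n * ln \<beta> \<noteq> real m * ln \<alpha>" if "m \<ge> 1" for m n :: nat
  proof
    assume eq: "real n * ln \<beta> = real m * ln \<alpha>"
    then have "n \<noteq> 0" using that \<alpha> by (cases n) auto
    then have "log \<alpha> \<beta> = real m / real n"
      using eq \<alpha> by (simp add: log_def field_simps)
    then show False using irr by simp
  qed
  have "enat (Suc N) \<le> max_empty_polygon (exp_lattice \<alpha> \<beta>)" for N
    using convex_empty_irrational_exists[OF \<alpha> \<beta> indep, of N] convex_empty_card_le[OF \<alpha> \<beta>] by metis
  then show ?thesis
    by (cases "max_empty_polygon (exp_lattice \<alpha> \<beta>)") (auto simp: not_less_eq_eq[symmetric])
qed

text \<open>Since \<open>\<beta> ^ q = \<alpha> ^ p\<close>, the sublattice with first exponents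
  divisible by \<open>p\<close> and second ones by \<open>q\<close> has equal bases.\<close>

lemma max_empty_polygon_rational_le:
  fixes p q :: nat
  assumes "\<alpha> > 1" "p \<ge> 1" "q \<ge> 1" and \<beta>: "\<beta> = \<alpha> powr (real p / real q)"
  shows "max_empty_polygon (exp_lattice \<alpha> \<beta>)
    \<le> enat (p * q) * max_empty_polygon (exp_lattice (\<alpha> ^ p) (\<alpha> ^ p))"
proof -
  have "\<beta> ^ q = \<alpha> ^ p"
    using assms by (simp add: powr_powr flip: powr_realpow)
  moreover have "\<beta> > 1" using assms by simp
  ultimately show ?thesis
    using max_empty_polygon_power_le[of \<alpha> \<beta> p q] assms by simp
qed

text \<open>With \<open>\<alpha> = \<delta> ^ q\<close> and \<open>\<beta> = \<delta> ^ p\<close>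
  the lattice is itself a sublattice of the one with both bases \<open>\<delta>\<close>, so the
  power inequality now bounds its value from below.\<close>

lemma max_empty_polygon_rational_ge:
  fixes p q :: nat
  assumes "\<alpha> > 1" "p \<ge> 1" "q \<ge> 1" and \<beta>: "\<beta> = \<alpha> powr (real p / real q)"
  shows "enat (nat \<lfloor>1 / (real p * real q) * real_of_int \<lfloor>sqrt (1 / (\<alpha> powr (1 / real q) - 1))\<rfloor>\<rfloor>)
    \<le> max_empty_polygon (exp_lattice \<alpha> \<beta>)"
proof -
  define \<delta> where "\<delta> = \<alpha> powr (1 / real q)"
  define s where "s = \<lfloor>sqrt (1 / (\<delta> - 1))\<rfloor>"
  have \<delta>: "\<delta> > 1" using assms by (simp add: \<delta>_def)
  have "\<delta> ^ q = \<alpha>" "\<delta> ^ p = \<beta>"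
    using assms by (simp_all add: \<delta>_def powr_powr flip: powr_realpow)
  then have le: "enat (nat s) \<le> enat (q * p) * max_empty_polygon (exp_lattice \<alpha> \<beta>)"
    using max_empty_polygon_diagonal_ge[OF \<delta>] max_empty_polygon_power_le[OF \<delta> \<delta>, of q p] assms(2,3)
    unfolding s_def by (metis order_trans)
  show ?thesis
  proof (cases "max_empty_polygon (exp_lattice \<alpha> \<beta>)")
    case (enat h)
    then have "nat s \<le> q * p * h" using le by simp
    then have "s \<le> int (q * p * h)" by linarith
    then have "real_of_int s \<le> real_of_int (int (q * p * h))"
      using of_int_le_iff by blast
    then have "1 / (real p * real q) * real_of_int s \<le> real h"
      using assms(2,3) by (simp add: field_simps)
    then have "\<lfloor>1 / (real p * real q) * real_of_int s\<rfloor> \<le> int h" by linarith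
    then show ?thesis using enat by (simp add: s_def \<delta>_def)
  qed simp
qed

theorem theorem6:
  fixes \<alpha> \<beta> :: real
  assumes "\<alpha> > 1" and "\<beta> > 1"
  shows "(max_empty_polygon (exp_lattice \<alpha> \<beta>) \<noteq> \<infinity> \<longleftrightarrow> log \<alpha> \<beta> \<in> \<rat>)
    \<and> (log \<alpha> \<beta> \<in> \<rat> \<longrightarrow>
        (\<exists>p q :: nat. p \<ge> 1 \<and> q \<ge> 1 \<and> \<beta> = \<alpha> powr (real p / real q))
      \<and> (\<forall>p q :: nat. p \<ge> 1 \<and> q \<ge> 1 \<and> \<beta> = \<alpha> powr (real p / real q) \<longrightarrow>
          enat (nat \<lfloor>1 / (real p * real q)
            * real_of_int \<lfloor>sqrt (1 / (\<alpha> powr (1 / real q) - 1))\<rfloor>\<rfloor>)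
            \<le> max_empty_polygon (exp_lattice \<alpha> \<beta>)
        \<and> max_empty_polygon (exp_lattice \<alpha> \<beta>)
            \<le> enat (p * q) * max_empty_polygon (exp_lattice (\<alpha> ^ p) (\<alpha> ^ p))))"
proof -
  have ex: "\<exists>p q :: nat. p \<ge> 1 \<and> q \<ge> 1 \<and> \<beta> = \<alpha> powr (real p / real q)" if rat: "log \<alpha> \<beta> \<in> \<rat>"
  proof -
    obtain p q :: nat where q: "q \<noteq> 0" and pq: "\<bar>log \<alpha> \<beta>\<bar> = real p / real q"
      using Rats_abs_nat_div_natE[OF rat] by metis
    \<comment> \<open>Positivity removes the absolute value and makes \<open>p\<close>
      nonzero.\<close>
    have "log \<alpha> \<beta> > 0" using assms by simp
    then have log: "log \<alpha> \<beta> = real p / real q" and "p \<noteq> 0"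
      using pq by (auto intro!: gr0I)
    have "\<beta> = \<alpha> powr log \<alpha> \<beta>" using assms by simp
    then show ?thesis
      using q \<open>p \<noteq> 0\<close> log by (metis Suc_leI One_nat_def neq0_conv)
  qed
  have "max_empty_polygon (exp_lattice \<alpha> \<beta>) \<noteq> \<infinity>" if rat: "log \<alpha> \<beta> \<in> \<rat>"
  proof -
    obtain p q :: nat where pq: "p \<ge> 1" "q \<ge> 1" "\<beta> = \<alpha> powr (real p / real q)"
      using ex[OF rat] by blast
    obtain h where "max_empty_polygon (exp_lattice (\<alpha> ^ p) (\<alpha> ^ p)) = enat h"
      using max_empty_polygon_diagonal_finite[of "\<alpha> ^ p"] assms pq by auto
    then have "max_empty_polygon (exp_lattice \<alpha> \<beta>) \<le> enat (p * q) * enat h"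
      using max_empty_polygon_rational_le[OF assms(1) pq] by simp
    then show ?thesis
      by (cases "max_empty_polygon (exp_lattice \<alpha> \<beta>)") auto
  qed
  then have iff: "max_empty_polygon (exp_lattice \<alpha> \<beta>) \<noteq> \<infinity> \<longleftrightarrow> log \<alpha> \<beta> \<in> \<rat>"
    using max_empty_polygon_irrational[OF assms] by (cases "log \<alpha> \<beta> \<in> \<rat>") simp_all
  note bounds = max_empty_polygon_rational_ge[OF assms(1)] max_empty_polygon_rational_le[OF assms(1)]
  show ?thesis
    by (intro conjI impI allI; (elim conjE)?) (rule iff, erule ex, (erule (2) bounds)+)
qed

end
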